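(* For $k,m\in\mathbb N$ and $\lambda,\delta\in(0,1)$, for any $P$ with marginal distribution over $\mathcal X=\mathbb R^k$ that is a product distribution with marginals having continuous CDFs, and for $\mathcal F$ the space of axis-aligned rectangles $h$ on $\mathbb R^k$ with $P((x,y):h(x)=1)\ge\lambda$, $$\mathcal B_{\hat n}(m,\delta)\le\frac{8k}{\lambda}\ln\left(\frac{8k}{\delta}\right).$$
   Context: Let $\mathcal X=\mathbb R^k$ and $\mathcal Y=\{-1,+1\}$. An axis-aligned rectangle on $\mathbb R^k$ is a classifier of the form $h(x'_1,\ldots,x'_k)=2\prod_{j=1}^k\mathbf 1_{[a_j,b_j]}(x'_j)-1$ for some $a_1,\ldots,a_k,b_1,\ldots,b_k\in\mathbb R$. $P$ is a probability measure on $\mathcal X\times\mathcal Y$ satisfying the realizable-case assumption: there is a target function $f^*\in\mathcal F$ with $\mathbb P(Y=f^*(x)\mid X=x)=1$ for all $x\in\mathcal X$, where $(X,Y)\sim P$. Let $(x_1,y_1),(x_2,y_2),\ldots$ be i.i.d. with distribution $P$, $S_m=\{(x_1,y_1),\ldots,(x_m,y_m)\}$, and suppose $y_i=f^*(x_i)$ for all $i$ (true with probability 1). For a finite sample $S$, $\mathrm{VS}_{\mathcal F,S}=\{h\in\mathcal F:\forall(x,y)\in S,\ h(x)=y\}$, and $\hat n(S)=\hat n(\mathcal F,S)$ is the size of a smallest subset $C\subseteq S$ with $\mathrm{VS}_{\mathcal F,C}=\mathrm{VS}_{\mathcal F,S}$. Define $$\mathcal B_{\hat n}(m,\delta)=\min\{b\in\mathbb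 N\cup\{0\}:\mathbb P(\hat n(S_m)\le b)\ge1-\delta\}.$$ *)

theory Defs
  imports "HOL-Probability.Probability"
begin

text \<open>
  Labels are the integers -1 and 1, so a distribution over labelled points is a measure on
  \<open>borel \<Otimes>\<^sub>M count_space labels\<close>, and classifiers are functions \<open>real^'k \<Rightarrow> int\<close>.
\<close>

definition labels :: "int set" where
  "labels = {-1, 1}"

definition example_space :: "((real^'k) \<times> int) measure" where
  "example_space = borel \<Otimes>\<^sub>M count_space labels"

definition rectangle :: "real^'k \<Rightarrow> real^'k \<Rightarrow> real^'k \<Rightarrow> int" where
  "rectangle a b x = 2 * (\<Prod>j\<in>UNIV. indicator {a $ j..b $ j} (x $ j)) - 1"

definition rectangle_class :: "((real^'k) \<times> int) measure \<Rightarrow> real \<Rightarrow> (real^'k \<Rightarrow> int) set" where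
  "rectangle_class P lam =
     {h. (\<exists>a b. h = rectangle a b) \<and> measure P {z \<in> space P. h (fst z) = 1} \<ge> lam}"

definition marginal_X :: "((real^'k) \<times> int) measure \<Rightarrow> (real^'k) measure" where
  "marginal_X P = distr P borel fst"

definition coord_marginal :: "(real^'k) measure \<Rightarrow> 'k \<Rightarrow> real measure" where
  "coord_marginal \<mu> j = distr \<mu> borel (\<lambda>x. x $ j)"

text \<open>
  \<open>vec_lambda\<close> transports the product measure from functions \<open>'k \<Rightarrow> real\<close> to vectors.
\<close>

definition product_distribution :: "(real^'k) measure \<Rightarrow> bool" where
  "product_distribution \<mu> \<longleftrightarrow>
     \<mu> = distr (\<Pi>\<^sub>M j\<in>UNIV. coord_marginal \<mu> j) borel vec_lambda"

text \<open>
  \<open>K x\<close> is a regular version of the conditional distribution of the label given the point \<open>x\<close>.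
  Such versions are unique only up to null sets of the marginal, so the requirement that the
  conditional probability equal 1 at every \<open>x\<close> is read as a property of some version.
\<close>

definition conditional_label_distribution ::
    "((real^'k) \<times> int) measure \<Rightarrow> (real^'k \<Rightarrow> int measure) \<Rightarrow> bool" where
  "conditional_label_distribution P K \<longleftrightarrow>
     K \<in> measurable borel (prob_algebra (count_space labels)) \<and>
     (\<forall>A \<in> sets borel. \<forall>B \<subseteq> labels.
        emeasure P (A \<times> B) = (\<integral>\<^sup>+x\<in>A. emeasure (K x) B \<partial>marginal_X P))"

definition realizable_by :: "((real^'k) \<times> int) measure \<Rightarrow> (real^'k \<Rightarrow> int) \<Rightarrow> bool" where
  "realizable_by P f \<longleftrightarrow>
     (\<exists>K. conditional_label_distribution P K \<and> (\<forall>x. measure (K x) {f x} = 1))"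

definition iid_sequence :: "'w measure \<Rightarrow> 'z measure \<Rightarrow> (nat \<Rightarrow> 'w \<Rightarrow> 'z) \<Rightarrow> bool" where
  "iid_sequence M P Z \<longleftrightarrow>
     prob_space.indep_vars M (\<lambda>_. P) Z {1..} \<and> (\<forall>i\<ge>1. distr M P (Z i) = P)"

definition sample :: "(nat \<Rightarrow> 'w \<Rightarrow> 'z) \<Rightarrow> nat \<Rightarrow> 'w \<Rightarrow> 'z set" where
  "sample Z m \<omega> = (\<lambda>i. Z i \<omega>) ` {1..m}"

definition version_space :: "('x \<Rightarrow> 'y) set \<Rightarrow> ('x \<times> 'y) set \<Rightarrow> ('x \<Rightarrow> 'y) set" where
  "version_space F S = {h \<in> F. \<forall>(x, y) \<in> S. h x = y}"

definition n_hat :: "('x \<Rightarrow> 'y) set \<Rightarrow> ('x \<times> 'y) set \<Rightarrow> nat" where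
  "n_hat F S = Min (card ` {C. C \<subseteq> S \<and> version_space F C = version_space F S})"

definition B_n_hat ::
    "'w measure \<Rightarrow> ('x \<Rightarrow> 'y) set \<Rightarrow> (nat \<Rightarrow> 'w \<Rightarrow> 'x \<times> 'y) \<Rightarrow> nat \<Rightarrow> real \<Rightarrow> nat" where
  "B_n_hat M F Z m \<delta> =
     (LEAST b. measure M {\<omega> \<in> space M. n_hat F (sample Z m \<omega>) \<le> b} \<ge> 1 - \<delta>)"

end

theory Submission
  imports Defs
begin

text \<open>
  Write \<open>L = ln (8k/\<delta>)\<close>. If \<open>m \<le> 8kL/\<lambda>\<close>, the bound \<open>n_hat \<le> m\<close> suffices. Otherwise let \<open>[a, b]\<close> be
  the target box and measure lengths along each axis by the marginal. With probability at least
  \<open>1 - \<delta>\<close>, each of the \<open>2k\<close> inner strips of the box (a fraction \<open>1/(8k)\<close> of its width) contains a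
  sample point; outside each of the \<open>2k\<close> faces, the slab of thickness \<open>t = 4L/(3m\<lambda>)\<close> over the inner
  box contains a sample point; and at most \<open>7kL/\<lambda>\<close> sample points exceed some face by at most \<open>t\<close>.
  On this event the version space is determined by the \<open>2k\<close> extremal positive points together with
  the near negative points: a rectangle that contains all positive points and a negative point
  beyond distance \<open>t\<close> from some face also contains the sample point in the slab over that face.

  The minimum in \<open>B_n_hat\<close> is only meaningful if \<open>{n_hat \<le> b}\<close> is an event: the rectangles of mass
  at least \<open>\<lambda>\<close> form a closed set of corner pairs, so the point configurations on which a given
  labelling is realised are projections of F-sigma sets along a sigma-compact space, hence Borel.
\<close>

section \<open>Measurability of the compression size\<close>

text \<open>Kuratowski's theorem: projecting away a compact factor is a closed map. It is applied to
  the subspace \<open>S\<close> and the trace of \<open>T\<close> on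
  \<open>S \<times> UNIV\<close>.\<close>

lemma closed_projection_along_compact:
  fixes T :: "('p::topological_space \<times> 'x::topological_space) set"
  assumes "compact S" "closed T"
  shows "closed {y. \<exists>x\<in>S. (x, y) \<in> T}"
proof -
  have "closed_map (prod_topology (top_of_set S) euclidean) (euclidean :: 'x topology) snd"
    using assms(1) by (intro closed_map_snd) (simp add: compact_space_subtopology compactin_euclidean_iff)
  moreover have "prod_topology (top_of_set S) (euclidean :: 'x topology) = top_of_set (S \<times> UNIV)"
    by (simp add: prod_topology_subtopology(1) euclidean_product_topology)
  moreover have "closedin (top_of_set (S \<times> UNIV)) ((S \<times> UNIV) \<inter> T)"
    using assms(2) by (simp add: closedin_closed_Int)
  ultimately have "closed (snd ` ((S \<times> UNIV) \<inter> T))"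
    by (metis closed_closedin closed_map_def)
  moreover have "snd ` ((S \<times> UNIV) \<inter> T) = {y. \<exists>x\<in>S. (x, y) \<in> T}"
    by force
  ultimately show ?thesis by simp
qed

text \<open>Writing \<open>Q\<close> as a countable union of closed sets and the parameter space as
  a countable union of compact balls turns the projection into a countable union of closed sets. For
  a general Borel set the projection would only be analytic, hence the F-sigma hypothesis.\<close>

lemma borel_projection_fsigma:
  fixes Q :: "('p::euclidean_space \<times> 'x::topological_space) set"
  assumes "fsigma_in euclidean Q"
  shows "{y. \<exists>x. (x, y) \<in> Q} \<in> sets borel"
proof -
  obtain C where C: "\<And>n::nat. closed (C n)" and Q: "\<Union> (range C) = Q"
    using assms by (auto simp: fsigma_in_ascending)
  have "{y. \<exists>x. (x, y) \<in> Q} = (\<Union>n. \<Union>r::nat. {y. \<exists>x\<in>cball 0 (real r). (x, y) \<in> C n})"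
    unfolding Q[symmetric] by (auto simp: Bex_def) (metis real_arch_simple)
  moreover have "{y. \<exists>x\<in>cball 0 (real r). (x, y) \<in> C n} \<in> sets borel" for n r
    by (intro borel_closed closed_projection_along_compact compact_cball C)
  ultimately show ?thesis by auto
qed

text \<open>The extra factor \<open>Y\<close> covers empty \<open>I\<close>, where the bare
  intersection is \<open>UNIV\<close> and need not lie in the carrier of \<open>X\<close>.\<close>

lemma fsigma_in_finite_INT:
  assumes "finite I" "\<And>i. i \<in> I \<Longrightarrow> fsigma_in X (f i)" "fsigma_in X Y"
  shows "fsigma_in X (Y \<inter> (\<Inter>i\<in>I. f i))"
  using assms(1,2)
proof (induction I)
  case (insert i I)
  have "Y \<inter> (\<Inter>j\<in>insert i I. f j) = f i \<inter> (Y \<inter> (\<Inter>j\<in>I. f j))"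
    by auto
  then show ?case using insert by (simp add: fsigma_in_Int)
qed (simp add: assms(3))

text \<open>Membership of a point in a box is a closed condition on corners and points jointly.
  Non-membership is open, hence F-sigma in a metrizable space; indexing the points by
  \<open>nat\<close> keeps the product topology metrizable. What remains is to project away the
  corners.\<close>

lemma borel_box_pattern:
  fixes \<Theta> :: "('a::euclidean_space \<times> 'a) set"
  assumes "closed \<Theta>" "finite A" "finite B"
  shows "{x :: nat \<Rightarrow> 'a. \<exists>a b. (a, b) \<in> \<Theta> \<and> (\<forall>i\<in>A. x i \<in> cbox a b) \<and> (\<forall>i\<in>B. x i \<notin> cbox a b)}
           \<in> sets borel"
proof -
  define H where "H i = {q :: ('a \<times> 'a) \<times> (nat \<Rightarrow> 'a). snd q i \<in> cbox (fst (fst q)) (snd (fst q))}" for i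
  have cont: "continuous_on UNIV (\<lambda>q :: ('a \<times> 'a) \<times> (nat \<Rightarrow> 'a). snd q i)" for i
    by (rule continuous_on_compose2[OF continuous_on_product_coordinates continuous_on_snd]) auto
  have closedH: "closed (H i)" for i
    unfolding H_def mem_box Ball_def
    by (intro closed_Collect_all closed_Collect_imp closed_Collect_conj closed_Collect_le
        continuous_intros cont) auto
  have fH: "fsigma_in euclidean (H i)" for i
    using closedH by (simp add: closed_imp_fsigma_in)
  have fH': "fsigma_in euclidean (- H i)" for i
    using closedH by (intro open_imp_fsigma_in) (auto simp: metrizable_space_euclidean open_Compl)
  have f\<Theta>: "fsigma_in euclidean (\<Theta> \<times> (UNIV :: (nat \<Rightarrow> 'a) set))"
    using assms(1) by (intro closed_imp_fsigma_in) (simp add: closed_Times)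
  have "fsigma_in euclidean ((\<Theta> \<times> UNIV \<inter> (\<Inter>i\<in>A. H i)) \<inter> (\<Inter>i\<in>B. - H i))"
    by (intro fsigma_in_finite_INT assms fH fH' f\<Theta>)
  from borel_projection_fsigma[OF this] show ?thesis
    by (simp add: H_def Bex_def)
qed

text \<open>\<open>cbox a b\<close> is the intersection of its closed neighbourhoods, each of which contains the boxes
  with nearby corners.\<close>

lemma closed_measure_cbox_ge:
  fixes \<mu> :: "'a::euclidean_space measure"
  assumes "finite_measure \<mu>" and [measurable_cong]: "sets \<mu> = sets borel"
  shows "closed {(a, b). c \<le> measure \<mu> (cbox a b)}"
  unfolding closed_sequential_limits
proof (intro allI impI, elim conjE)
  interpret finite_measure \<mu> by fact
  fix X :: "nat \<Rightarrow> 'a \<times> 'a" and l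
  assume X: "\<forall>n. X n \<in> {(a, b). c \<le> measure \<mu> (cbox a b)}" and lim: "X \<longlonglongrightarrow> l"
  obtain a b where l: "l = (a, b)" by force
  define e where "e n = 1 / real (Suc n)" for n
  define D :: "nat \<Rightarrow> 'a set" where "D n = cbox (a - e n *\<^sub>R One) (b + e n *\<^sub>R One)" for n
  have e: "e n > 0" "m \<ge> n \<Longrightarrow> e m \<le> e n" for n m
    by (auto simp: e_def frac_le)
  have D_sets: "range D \<subseteq> sets \<mu>"
    by (auto simp: D_def assms(2))
  have "decseq D"
    unfolding decseq_def
  proof (intro allI impI)
    fix n k :: nat assume "n \<le> k"
    then have "e k \<le> e n" by (simp add: e)
    then show "D k \<le> D n"
      unfolding D_def by (intro subset_box_imp) (auto simp: inner_diff_left inner_add_left)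
  qed
  then have "(\<lambda>n. measure \<mu> (D n)) \<longlonglongrightarrow> measure \<mu> (\<Inter>n. D n)"
    by (intro finite_Lim_measure_decseq D_sets)
  moreover have "(\<Inter>n. D n) = cbox a b"
  proof (intro set_eqI iffI)
    fix x assume x: "x \<in> (\<Inter>n. D n)"
    have e0: "e \<longlonglongrightarrow> 0" unfolding e_def using LIMSEQ_Suc lim_1_over_n by blast
    have "a \<bullet> i \<le> x \<bullet> i \<and> x \<bullet> i \<le> b \<bullet> i" if i: "i \<in> Basis" for i
    proof -
      have *: "a \<bullet> i - e n \<le> x \<bullet> i \<and> x \<bullet> i \<le> b \<bullet> i + e n" for n
        using x i by (auto simp: D_def mem_box inner_diff_left inner_add_left)
      have "(\<lambda>n. a \<bullet> i - e n) \<longlonglongrightarrow> a \<bullet> i - 0" "(\<lambda>n. b \<bullet> i + e n) \<longlonglongrightarrow> b \<bullet> i + 0"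
        by (intro tendsto_intros e0)+
      then show ?thesis
        using * by (auto intro: LIMSEQ_le_const LIMSEQ_le_const2)
    qed
    then show "x \<in> cbox a b" by (auto simp: mem_box)
  next
    fix x assume "x \<in> cbox a b"
    then have "a \<bullet> i - e n \<le> x \<bullet> i \<and> x \<bullet> i \<le> b \<bullet> i + e n" if "i \<in> Basis" for i n
      using that e(1)[of n] unfolding mem_box by (meson add_increasing2 diff_le_eq less_imp_le)
    then show "x \<in> (\<Inter>n. D n)"
      by (auto simp: D_def mem_box inner_diff_left inner_add_left)
  qed
  moreover have "c \<le> measure \<mu> (D n)" for n
  proof -
    have "eventually (\<lambda>k. dist (X k) l < e n) sequentially"
      using lim e(1) by (rule tendstoD)
    then obtain k where k: "dist (X k) l < e n"
      by (meson eventually_sequentially order_refl)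
    obtain a' b' where X': "X k = (a', b')" by force
    have d: "norm (a' - a) < e n" "norm (b' - b) < e n"
      using k dist_fst_le[of "X k" l] dist_snd_le[of "X k" l] by (auto simp: X' l dist_norm)
    have "cbox a' b' \<subseteq> D n"
    proof
      fix x assume x: "x \<in> cbox a' b'"
      have "a \<bullet> i - e n \<le> x \<bullet> i \<and> x \<bullet> i \<le> b \<bullet> i + e n" if i: "i \<in> Basis" for i
      proof -
        have "\<bar>(a' - a) \<bullet> i\<bar> < e n" "\<bar>(b' - b) \<bullet> i\<bar> < e n"
          using d Basis_le_norm[OF i] by (meson le_less_trans)+
        moreover have "a' \<bullet> i \<le> x \<bullet> i" "x \<bullet> i \<le> b' \<bullet> i" using x i by (auto simp: mem_box)
        ultimately show ?thesis by (auto simp: inner_diff_left abs_less_iff)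
      qed
      then show "x \<in> D n" by (auto simp: D_def mem_box inner_diff_left inner_add_left)
    qed
    then have "measure \<mu> (cbox a' b') \<le> measure \<mu> (D n)"
      by (intro finite_measure_mono) (auto simp: D_def assms(2))
    then show ?thesis using X[rule_format, of k] by (simp add: X')
  qed
  ultimately have "c \<le> measure \<mu> (cbox a b)"
    by (auto intro: LIMSEQ_le_const)
  then show "l \<in> {(a, b). c \<le> measure \<mu> (cbox a b)}" by (simp add: l)
qed

section \<open>Rectangles as boxes, and compression of indexed samples\<close>

lemma rectangle_conv_cbox: "rectangle a b x = (if x \<in> cbox a b then 1 else -1)"
proof (cases "x \<in> cbox a b")
  case True
  then have "(\<Prod>j\<in>UNIV. indicator {a $ j..b $ j} (x $ j)) = (1 :: int)"
    by (intro prod.neutral) (auto simp: mem_box_cart)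
  then show ?thesis using True by (simp add: rectangle_def)
next
  case False
  then obtain j where "x $ j \<notin> {a $ j..b $ j}" by (auto simp: mem_box_cart)
  then have "(\<Prod>j\<in>UNIV. indicator {a $ j..b $ j} (x $ j)) = (0 :: int)"
    by (intro prod_zero) (auto simp: indicator_def intro!: exI[of _ j])
  then show ?thesis using False by (simp add: rectangle_def)
qed

lemma n_hat_le_iff:
  assumes "finite S"
  shows "n_hat F S \<le> b \<longleftrightarrow> (\<exists>C\<subseteq>S. version_space F C = version_space F S \<and> card C \<le> b)"
proof -
  let ?K = "{C. C \<subseteq> S \<and> version_space F C = version_space F S}"
  have "finite ?K" using assms by (auto intro: finite_subset[of _ "Pow S"])
  moreover have "S \<in> ?K" by simp
  ultimately show ?thesis
    unfolding n_hat_def by (subst Min_le_iff) auto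
qed

text \<open>Passing from subsets of the random sample to subsets of the fixed index set makes the
  quantifier range independent of the outcome. Repeated points do no harm: a subset of the image has
  an index set on which \<open>f\<close> is injective, so the cardinality is preserved.\<close>

lemma n_hat_image_le_iff:
  assumes "finite I"
  shows "n_hat F (f ` I) \<le> b \<longleftrightarrow>
           (\<exists>J\<subseteq>I. version_space F (f ` J) = version_space F (f ` I) \<and> card J \<le> b)"
proof -
  have "(\<exists>C\<subseteq>f ` I. version_space F C = version_space F (f ` I) \<and> card C \<le> b) \<longleftrightarrow>
        (\<exists>J\<subseteq>I. version_space F (f ` J) = version_space F (f ` I) \<and> card J \<le> b)" (is "?l \<longleftrightarrow> ?r")
  proof
    assume ?l
    then obtain C where C: "C \<subseteq> f ` I" "version_space F C = version_space F (f ` I)" "card C \<le> b" by blast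
    then obtain J where J: "J \<subseteq> I" "inj_on f J" "C = f ` J" by (meson subset_image_inj)
    then show ?r using C by (auto simp: card_image)
  next
    assume ?r
    then obtain J where J: "J \<subseteq> I" "version_space F (f ` J) = version_space F (f ` I)" "card J \<le> b" by blast
    then have "card (f ` J) \<le> b"
      using assms card_image_le[of J f] finite_subset[of J I] by linarith
    then show ?l using J by (intro exI[of _ "f ` J"]) auto
  qed
  then show ?thesis using assms by (simp add: n_hat_le_iff)
qed

lemma version_space_antimono: "C \<subseteq> S \<Longrightarrow> version_space F S \<subseteq> version_space F C"
  by (auto simp: version_space_def)

text \<open>A rectangle interacts with the sample only through the set \<open>A\<close> of indices
  whose points it contains. Equality of version spaces therefore reduces to a finite condition:
  every realisable pattern \<open>A\<close> that fits the labels on \<open>J\<close> also fits them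
  on \<open>I\<close>.\<close>

lemma version_space_image_eq_iff:
  fixes z :: "nat \<Rightarrow> (real^'k) \<times> int"
  assumes F: "F = (\<lambda>(a, b). rectangle a b) ` \<Theta>"
    and J: "J \<subseteq> I" and lab: "\<And>i. i \<in> I \<Longrightarrow> snd (z i) \<in> labels"
  shows "version_space F (z ` J) = version_space F (z ` I) \<longleftrightarrow>
     (\<forall>A\<in>Pow I. (\<exists>a b. (a, b) \<in> \<Theta> \<and> (\<forall>i\<in>A. fst (z i) \<in> cbox a b) \<and> (\<forall>i\<in>I - A. fst (z i) \<notin> cbox a b))
         \<longrightarrow> (\<forall>i\<in>J. snd (z i) = 1 \<longleftrightarrow> i \<in> A) \<longrightarrow> (\<forall>i\<in>I. snd (z i) = 1 \<longleftrightarrow> i \<in> A))"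
    (is "?l \<longleftrightarrow> (\<forall>A\<in>Pow I. ?R A \<longrightarrow> _ \<longrightarrow> _)")
proof -
  have mem: "rectangle a b \<in> version_space F (z ` K) \<longleftrightarrow>
      rectangle a b \<in> F \<and> (\<forall>i\<in>K. snd (z i) = 1 \<longleftrightarrow> fst (z i) \<in> cbox a b)" if "K \<subseteq> I" for a b K
  proof -
    have "rectangle a b (fst (z i)) = snd (z i) \<longleftrightarrow> (snd (z i) = 1 \<longleftrightarrow> fst (z i) \<in> cbox a b)" if "i \<in> I" for i
      using lab[OF that] by (auto simp: rectangle_conv_cbox labels_def)
    then show ?thesis using that by (auto simp: version_space_def case_prod_beta)
  qed
  show ?thesis
  proof
    assume l: ?l
    show "\<forall>A\<in>Pow I. ?R A \<longrightarrow> (\<forall>i\<in>J. snd (z i) = 1 \<longleftrightarrow> i \<in> A) \<longrightarrow> (\<forall>i\<in>I. snd (z i) = 1 \<longleftrightarrow> i \<in> A)"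
    proof (intro ballI impI)
      fix A i assume A: "A \<in> Pow I" "?R A" "\<forall>i\<in>J. snd (z i) = 1 \<longleftrightarrow> i \<in> A" and i: "i \<in> I"
      then obtain a b where ab: "(a, b) \<in> \<Theta>" "\<forall>i\<in>A. fst (z i) \<in> cbox a b" "\<forall>i\<in>I - A. fst (z i) \<notin> cbox a b"
        by blast
      have "rectangle a b \<in> version_space F (z ` J)"
        using ab A(3) J by (subst mem[OF J]) (auto simp: F image_iff Bex_def)
      then have "rectangle a b \<in> version_space F (z ` I)" using l by simp
      then show "snd (z i) = 1 \<longleftrightarrow> i \<in> A" using mem[of I a b] i ab by auto
    qed
  next
    assume r: "\<forall>A\<in>Pow I. ?R A \<longrightarrow> (\<forall>i\<in>J. snd (z i) = 1 \<longleftrightarrow> i \<in> A) \<longrightarrow> (\<forall>i\<in>I. snd (z i) = 1 \<longleftrightarrow> i \<in> A)"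
    have "version_space F (z ` J) \<subseteq> version_space F (z ` I)"
    proof
      fix h assume h: "h \<in> version_space F (z ` J)"
      then obtain a b where ab: "(a, b) \<in> \<Theta>" "h = rectangle a b" by (auto simp: version_space_def F)
      \<comment> \<open>This is the pattern that \<open>h\<close> itself cuts out of the
        sample.\<close>
      let ?A = "{i\<in>I. fst (z i) \<in> cbox a b}"
      have hJ: "h \<in> F" "\<forall>i\<in>J. snd (z i) = 1 \<longleftrightarrow> fst (z i) \<in> cbox a b" using h mem[OF J] ab by auto
      moreover have "?R ?A" using ab(1) by (intro exI[of _ a] exI[of _ b]) auto
      moreover have "\<forall>i\<in>J. snd (z i) = 1 \<longleftrightarrow> i \<in> ?A" using hJ J by auto
      ultimately have "\<forall>i\<in>I. snd (z i) = 1 \<longleftrightarrow> i \<in> ?A" using r[THEN bspec, of ?A] by blast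
      then show "h \<in> version_space F (z ` I)" using mem[of I] ab hJ by auto
    qed
    moreover have "version_space F (z ` I) \<subseteq> version_space F (z ` J)"
      using version_space_antimono[OF image_mono[OF J]] .
    ultimately show ?l by blast
  qed
qed

text \<open>The event is a finite Boolean combination of label events and of the events that a given
  pattern is realised by a box with corners in \<open>\<Theta>\<close>; the latter are Borel by the
  projection argument.\<close>

lemma n_hat_measurable:
  fixes Z :: "nat \<Rightarrow> 'w \<Rightarrow> (real^'k) \<times> int"
  assumes F: "F = (\<lambda>(a, b). rectangle a b) ` \<Theta>" and \<Theta>: "closed \<Theta>" and I: "finite I"
    and Z: "\<And>i. i \<in> I \<Longrightarrow> Z i \<in> measurable M example_space"
  shows "{\<omega> \<in> space M. n_hat F ((\<lambda>i. Z i \<omega>) ` I) \<le> b} \<in> sets M"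
proof -
  \<comment> \<open>Nothing is known about \<open>Z i\<close> outside \<open>I\<close>, so a
    constant fills these coordinates. The patterns only inspect indices in \<open>I\<close>.\<close>
  define X where "X \<omega> i = (if i \<in> I then fst (Z i \<omega>) else 0)" for \<omega> i
  have X: "X \<in> measurable M borel"
  proof (rule measurable_coordinatewise_then_product)
    fix i show "(\<lambda>\<omega>. X \<omega> i) \<in> borel_measurable M"
      using Z[of i] unfolding X_def example_space_def by (cases "i \<in> I") auto
  qed
  have Y: "(\<lambda>\<omega>. snd (Z i \<omega>)) \<in> measurable M (count_space labels)" if "i \<in> I" for i
    using Z[OF that] unfolding example_space_def by measurable
  have Y1: "Measurable.pred M (\<lambda>\<omega>. snd (Z i \<omega>) = 1)" if "i \<in> I" for i
    using Y[OF that] by measurable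
  have lab: "snd (Z i \<omega>) \<in> labels" if "i \<in> I" "\<omega> \<in> space M" for i \<omega>
    using measurable_space[OF Y[OF that(1)] that(2)] by simp
  define R where "R A \<omega> \<longleftrightarrow> (\<exists>a b. (a, b) \<in> \<Theta> \<and> (\<forall>i\<in>A. X \<omega> i \<in> cbox a b) \<and> (\<forall>i\<in>I - A. X \<omega> i \<notin> cbox a b))" for A \<omega>
  have R: "Measurable.pred M (R A)" if "A \<in> Pow I" for A
  proof -
    have "{x. \<exists>a b. (a, b) \<in> \<Theta> \<and> (\<forall>i\<in>A. x i \<in> cbox a b) \<and> (\<forall>i\<in>I - A. x i \<notin> cbox a b)} \<in> sets borel"
      using that I by (intro borel_box_pattern \<Theta>) (auto intro: finite_subset)
    from measurable_sets[OF X this] show ?thesis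
      by (simp add: pred_def R_def vimage_def Int_def conj_commute)
  qed
  have eq: "version_space F ((\<lambda>i. Z i \<omega>) ` J) = version_space F ((\<lambda>i. Z i \<omega>) ` I) \<longleftrightarrow>
     (\<forall>A\<in>Pow I. R A \<omega> \<longrightarrow> (\<forall>i\<in>J. snd (Z i \<omega>) = 1 \<longleftrightarrow> i \<in> A) \<longrightarrow> (\<forall>i\<in>I. snd (Z i \<omega>) = 1 \<longleftrightarrow> i \<in> A))"
    if "J \<subseteq> I" "\<omega> \<in> space M" for J \<omega>
    using that lab
    by (subst version_space_image_eq_iff[OF F that(1)]) (auto simp: R_def X_def subset_iff intro!: ball_cong)
  have "Measurable.pred M (\<lambda>\<omega>. \<exists>J\<in>{J. J \<subseteq> I \<and> card J \<le> b}. \<forall>A\<in>Pow I. R A \<omega> \<longrightarrow>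
      (\<forall>i\<in>J. snd (Z i \<omega>) = 1 \<longleftrightarrow> i \<in> A) \<longrightarrow> (\<forall>i\<in>I. snd (Z i \<omega>) = 1 \<longleftrightarrow> i \<in> A))"
    using I
    by (intro pred_intros_finite pred_intros_logic R Y1) (auto intro: finite_subset finite_subset[of _ "Pow I"])
  then have "{\<omega> \<in> space M. \<exists>J\<in>{J. J \<subseteq> I \<and> card J \<le> b}. \<forall>A\<in>Pow I. R A \<omega> \<longrightarrow>
      (\<forall>i\<in>J. snd (Z i \<omega>) = 1 \<longleftrightarrow> i \<in> A) \<longrightarrow> (\<forall>i\<in>I. snd (Z i \<omega>) = 1 \<longleftrightarrow> i \<in> A)} \<in> sets M" (is "?S \<in> _")
    by (simp only: pred_def)
  moreover have "{\<omega> \<in> space M. n_hat F ((\<lambda>i. Z i \<omega>) ` I) \<le> b} = ?S"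
  proof (intro Collect_cong conj_cong refl)
    fix \<omega> assume \<omega>: "\<omega> \<in> space M"
    show "n_hat F ((\<lambda>i. Z i \<omega>) ` I) \<le> b \<longleftrightarrow> (\<exists>J\<in>{J. J \<subseteq> I \<and> card J \<le> b}. \<forall>A\<in>Pow I. R A \<omega> \<longrightarrow>
      (\<forall>i\<in>J. snd (Z i \<omega>) = 1 \<longleftrightarrow> i \<in> A) \<longrightarrow> (\<forall>i\<in>I. snd (Z i \<omega>) = 1 \<longleftrightarrow> i \<in> A))"
      unfolding n_hat_image_le_iff[OF I] Bex_def mem_Collect_eq
    proof (rule ex_cong1)
      fix J
      show "J \<subseteq> I \<and> version_space F ((\<lambda>i. Z i \<omega>) ` J) = version_space F ((\<lambda>i. Z i \<omega>) ` I) \<and> card J \<le> b \<longleftrightarrow>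
        (J \<subseteq> I \<and> card J \<le> b) \<and> (\<forall>A\<in>Pow I. R A \<omega> \<longrightarrow>
          (\<forall>i\<in>J. snd (Z i \<omega>) = 1 \<longleftrightarrow> i \<in> A) \<longrightarrow> (\<forall>i\<in>I. snd (Z i \<omega>) = 1 \<longleftrightarrow> i \<in> A))"
        using eq[OF _ \<omega>, of J] by argo
    qed
  qed
  ultimately show ?thesis by simp
qed

section \<open>A compression set from strips and slabs\<close>

text \<open>\<open>flip True\<close> and \<open>flip False\<close> treat the upper and the lower faces of a box alike.\<close>

definition flip :: "bool \<Rightarrow> real \<Rightarrow> real" where
  "flip s x = (if s then x else - x)"

lemma flip_measurable [measurable]: "flip s \<in> borel_measurable borel"
  unfolding flip_def by measurable

lemma mem_cbox_flip:
  "x \<in> cbox a b \<longleftrightarrow> (\<forall>j s. flip s (x $ j) \<le> flip s (if s then b $ j else a $ j))"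
  by (auto simp: mem_box_cart flip_def all_bool_eq)

text \<open>The deterministic core. For each face \<open>(j, s)\<close>, \<open>\<gamma> j s\<close>
  is the inner threshold of its strip and \<open>U j s\<close> the near part of the half-line beyond
  it. \<open>U\<close> is a set rather than a width, so that it can be the whole half-line when that
  has little mass. The compressing subset consists of one extremal positive point per face and all
  near points.\<close>

lemma n_hat_le_card_near:
  fixes S :: "((real^'k) \<times> int) set" and a b :: "real^'k"
    and \<gamma> :: "'k \<Rightarrow> bool \<Rightarrow> real" and U :: "'k \<Rightarrow> bool \<Rightarrow> real set"
  defines "\<beta> \<equiv> \<lambda>j s. flip s (if s then b $ j else a $ j)"
  assumes F: "\<And>h. h \<in> F \<Longrightarrow> \<exists>a b. h = rectangle a b"
    and fin: "finite S"
    and lab: "\<And>z. z \<in> S \<Longrightarrow> snd z = rectangle a b (fst z)"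
    and strip: "\<And>j s. \<exists>z\<in>S. fst z \<in> cbox a b \<and> \<gamma> j s \<le> flip s (fst z $ j)"
    and U_gt: "\<And>j s. U j s \<subseteq> {\<beta> j s<..}"
    and U_init: "\<And>j s u v. u \<in> U j s \<Longrightarrow> \<beta> j s < v \<Longrightarrow> v \<notin> U j s \<Longrightarrow> u \<le> v"
    and slab: "\<And>j s. U j s = {\<beta> j s<..} \<or>
       (\<exists>z\<in>S. flip s (fst z $ j) \<in> U j s \<and> (\<forall>i s'. i \<noteq> j \<longrightarrow> flip s' (fst z $ i) \<le> \<gamma> i s'))"
  shows "n_hat F S \<le> 2 * CARD('k) + card {z \<in> S. \<exists>j s. flip s (fst z $ j) \<in> U j s}"
proof -
  define pos where "pos = {z \<in> S. fst z \<in> cbox a b}"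
  define W where "W = {z \<in> S. \<exists>j s. flip s (fst z $ j) \<in> U j s}"
  have box: "x \<in> cbox a b \<longleftrightarrow> (\<forall>j s. flip s (x $ j) \<le> \<beta> j s)" for x
    unfolding \<beta>_def by (rule mem_cbox_flip)
  have pos: "finite pos" "pos \<noteq> {}"
    using fin strip unfolding pos_def by auto (metis prod.collapse)
  have "\<exists>z. z \<in> pos \<and> (\<forall>z'\<in>pos. flip s (fst z' $ j) \<le> flip s (fst z $ j))" for j s
  proof -
    let ?g = "\<lambda>z. flip s (fst z $ j)"
    have "Max (?g ` pos) \<in> ?g ` pos" using pos by (intro Max_in) auto
    then obtain z where "z \<in> pos" "Max (?g ` pos) = ?g z" by blast
    then show ?thesis using pos by (metis Max_ge finite_imageI imageI)
  qed
  then have "\<forall>j s. \<exists>z. z \<in> pos \<and> (\<forall>z'\<in>pos. flip s (fst z' $ j) \<le> flip s (fst z $ j))"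
    by blast
  then obtain p where "\<forall>j s. p j s \<in> pos \<and> (\<forall>z'\<in>pos. flip s (fst z' $ j) \<le> flip s (fst (p j s) $ j))"
    unfolding choice_iff by blast
  then have p: "p j s \<in> pos"
    and p_max: "z \<in> pos \<Longrightarrow> flip s (fst z $ j) \<le> flip s (fst (p j s) $ j)" for j s z
    by blast+
  define C where "C = (\<lambda>(j, s). p j s) ` UNIV \<union> W"
  have CS: "C \<subseteq> S" using p by (auto simp: C_def W_def pos_def)
  have "version_space F C \<subseteq> version_space F S"
  proof
    fix h assume h: "h \<in> version_space F C"
    then have hF: "h \<in> F" and hC: "\<And>z. z \<in> C \<Longrightarrow> h (fst z) = snd z"
      by (auto simp: version_space_def)
    obtain a' b' where h_def: "h = rectangle a' b'" using F[OF hF] by blast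
    define \<beta>' where "\<beta>' j s = flip s (if s then b' $ j else a' $ j)" for j s
    have box': "x \<in> cbox a' b' \<longleftrightarrow> (\<forall>j s. flip s (x $ j) \<le> \<beta>' j s)" for x
      unfolding \<beta>'_def by (rule mem_cbox_flip)
    have pC: "p j s \<in> C" for j s by (auto simp: C_def image_iff)
    have p_in: "fst (p j s) \<in> cbox a' b'" for j s
    proof -
      have "rectangle a b (fst (p j s)) = 1" "p j s \<in> S"
        using p[of j s] by (auto simp: pos_def rectangle_conv_cbox)
      then have "rectangle a' b' (fst (p j s)) = 1"
        using hC[OF pC[of j s]] lab by (simp add: h_def)
      then show ?thesis by (simp add: rectangle_conv_cbox split: if_splits)
    qed
    \<comment> \<open>Since \<open>h\<close> accepts the extremal positive points, its box reaches
      at least as far as every positive point in each direction.\<close>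
    have pos_le: "flip s (fst z $ j) \<le> \<beta>' j s" if "z \<in> pos" for z j s
      using p_max[OF that, of s j] p_in[of j s] by (meson box' order_trans)
    have "h (fst z) = snd z" if z: "z \<in> S" for z
    proof (rule ccontr)
      assume neq: "h (fst z) \<noteq> snd z"
      show False
      proof (cases "fst z \<in> cbox a b")
        case True
        then have "z \<in> pos" using z by (simp add: pos_def)
        then have "fst z \<in> cbox a' b'" using pos_le by (simp add: box')
        then show False using neq lab[OF z] True by (simp add: h_def rectangle_conv_cbox)
      next
        case False
        then have zin: "fst z \<in> cbox a' b'"
          using neq lab[OF z] by (simp add: h_def rectangle_conv_cbox split: if_splits)
        obtain j s where js: "\<beta> j s < flip s (fst z $ j)"
          using False by (auto simp: box not_le)
        \<comment> \<open>Near points belong to \<open>C\<close> and are classified correctly. So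
          the misclassified \<open>z\<close> lies beyond the near region, which is then not the
          whole half-line, and a slab point \<open>w\<close> exists.\<close>
        have notU: "flip s (fst z $ j) \<notin> U j s"
          using neq hC[of z] z by (auto simp: C_def W_def)
        then have "U j s \<noteq> {\<beta> j s<..}" using js by auto
        then obtain w where w: "w \<in> S" "flip s (fst w $ j) \<in> U j s"
          "\<And>i s'. i \<noteq> j \<Longrightarrow> flip s' (fst w $ i) \<le> \<gamma> i s'"
          using slab[of j s] by blast
        have wC: "w \<in> C" using w by (auto simp: C_def W_def)
        have wgt: "\<beta> j s < flip s (fst w $ j)" using w U_gt by blast
        then have w_neg: "fst w \<notin> cbox a b" unfolding box by (meson not_le)
        \<comment> \<open>\<open>w\<close> satisfies every face condition of the box of
          \<open>h\<close>: on axes other than \<open>j\<close> by the strip points, towards face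
          \<open>(j, s)\<close> by \<open>z\<close>, and on the opposite side of axis
          \<open>j\<close> by any positive point. So \<open>h\<close> accepts the negative point
          \<open>w\<close> of \<open>C\<close>, a contradiction.\<close>
        have "flip s' (fst w $ i) \<le> \<beta>' i s'" for i s'
        proof (cases "i = j")
          case False
          obtain z' where "z' \<in> S" "fst z' \<in> cbox a b" "\<gamma> i s' \<le> flip s' (fst z' $ i)"
            using strip by blast
          then show ?thesis
            using w(3)[OF False, of s'] pos_le[of z' s' i] by (simp add: pos_def)
        next
          case i: True
          show ?thesis
          proof (cases "s' = s")
            case True
            have "flip s (fst w $ j) \<le> flip s (fst z $ j)" using U_init[OF w(2) js notU] .
            also have "\<dots> \<le> \<beta>' j s" using zin by (simp add: box')
            finally show ?thesis using i True by simp
          next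
            case False
            obtain z' where z': "z' \<in> pos" using pos by blast
            then have "flip s (fst z' $ j) \<le> \<beta> j s" by (simp add: pos_def box)
            with wgt have "flip s (fst z' $ j) < flip s (fst w $ j)" by linarith
            then have "flip s' (fst w $ j) \<le> flip s' (fst z' $ j)"
              using False by (cases s; cases s') (auto simp: flip_def)
            then show ?thesis using i pos_le[OF z', of s' j] by simp
          qed
        qed
        then have "fst w \<in> cbox a' b'" by (simp add: box')
        then show False
          using hC[OF wC] lab[OF w(1)] w_neg by (simp add: h_def rectangle_conv_cbox)
      qed
    qed
    then show "h \<in> version_space F S" using hF by (auto simp: version_space_def)
  qed
  then have "version_space F C = version_space F S"
    using version_space_antimono[OF CS] by blast
  moreover have "card C \<le> 2 * CARD('k) + card W"
  proof -
    have "card ((\<lambda>(j, s). p j s) ` UNIV) \<le> CARD('k \<times> bool)"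
      by (rule card_image_le) simp
    also have "\<dots> = 2 * CARD('k)" by (simp add: card_UNIV_bool)
    finally show ?thesis unfolding C_def using card_Un_le add_le_mono1 order_trans by blast
  qed
  ultimately show ?thesis
    unfolding n_hat_le_iff[OF fin] W_def[symmetric] using CS by blast
qed

section \<open>Atomless distributions on the line\<close>

lemma atomless_isCont_cdf:
  fixes \<nu> :: "real measure"
  assumes "prob_space \<nu>" "sets \<nu> = sets borel" "\<And>x. measure \<nu> {x} = 0"
  shows "isCont (cdf \<nu>) x"
proof -
  interpret real_distribution \<nu>
    using assms by (simp add: real_distribution_def real_distribution_axioms_def)
  show ?thesis using assms(3) by (simp add: isCont_cdf)
qed

lemma atomless_measure_Icc:
  fixes \<nu> :: "real measure"
  assumes "prob_space \<nu>" "sets \<nu> = sets borel" "\<And>x. measure \<nu> {x} = 0" "a \<le> b"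
  shows "measure \<nu> {a..b} = cdf \<nu> b - cdf \<nu> a"
proof -
  interpret real_distribution \<nu>
    using assms by (simp add: real_distribution_def real_distribution_axioms_def)
  have "{a..b} = {a} \<union> {a<..b}" using assms(4) by auto
  then have "measure \<nu> {a..b} = measure \<nu> {a} + measure \<nu> {a<..b}"
    by (simp only:) (intro finite_measure_Union; simp)
  then show ?thesis using assms(3,4) cdf_diff_eq[of a b] by (cases "a = b") auto
qed

text \<open>Without atoms the CDF is continuous, so the intermediate value theorem yields the cut
  point.\<close>

lemma ex_upper_tail_point:
  fixes \<nu> :: "real measure"
  assumes \<nu>: "prob_space \<nu>" "sets \<nu> = sets borel" "\<And>x. measure \<nu> {x} = 0"
    and "a \<le> b" "0 \<le> e" "e \<le> 1"
  obtains c where "a \<le> c" "c \<le> b" "measure \<nu> {c..b} = e * measure \<nu> {a..b}"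
proof -
  let ?F = "cdf \<nu>"
  interpret real_distribution \<nu>
    using \<nu> by (simp add: real_distribution_def real_distribution_axioms_def)
  have le: "?F a \<le> ?F b" using \<open>a \<le> b\<close> by (rule cdf_nondecreasing)
  have "?F a \<le> ?F b - e * (?F b - ?F a)" "?F b - e * (?F b - ?F a) \<le> ?F b"
    using mult_right_mono[OF \<open>e \<le> 1\<close>, of "?F b - ?F a"] le \<open>0 \<le> e\<close> by auto
  then obtain c where c: "a \<le> c" "c \<le> b" "?F c = ?F b - e * (?F b - ?F a)"
    using IVT'[of ?F a _ b] \<open>a \<le> b\<close> atomless_isCont_cdf[OF \<nu>]
    by (metis continuous_at_imp_continuous_on)
  then show ?thesis
    using that[of c] atomless_measure_Icc[OF \<nu>] \<open>a \<le> b\<close> by simp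
qed

text \<open>A tail of mass at most \<open>t\<close> is taken whole; otherwise the intermediate value
  theorem cuts off exactly mass \<open>t\<close> next to \<open>b\<close>. The disjunction records
  that mass \<open>t\<close> may not be available.\<close>

lemma ex_outer_interval:
  fixes \<nu> :: "real measure"
  assumes \<nu>: "prob_space \<nu>" "sets \<nu> = sets borel" "\<And>x. measure \<nu> {x} = 0"
    and t: "0 \<le> t"
  obtains U where "U \<in> sets borel" "U \<subseteq> {b<..}" "\<And>u v. u \<in> U \<Longrightarrow> b < v \<Longrightarrow> v \<notin> U \<Longrightarrow> u \<le> v"
    "measure \<nu> U \<le> t" "U = {b<..} \<or> measure \<nu> U = t"
proof -
  let ?F = "cdf \<nu>"
  interpret real_distribution \<nu>
    using \<nu> by (simp add: real_distribution_def real_distribution_axioms_def)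
  show ?thesis
  proof (cases "measure \<nu> {b<..} \<le> t")
    case True
    then show ?thesis by (intro that[of "{b<..}"]) auto
  next
    case False
    have "{b<..} = space \<nu> - {..b}" by auto
    then have "measure \<nu> {b<..} = 1 - ?F b"
      by (simp add: cdf_def2 prob_compl del: space_eq_univ)
    with False have "?F b + t < 1" by simp
    \<comment> \<open>The tail has mass above \<open>t\<close>, so the CDF exceeds
      \<open>?F b + t\<close> at some finite \<open>y\<close>, which serves as right end for the
      intermediate value theorem.\<close>
    then have "eventually (\<lambda>y. ?F b + t < ?F y) at_top"
      using cdf_lim_at_top_prob by (simp add: order_tendstoD)
    then have "eventually (\<lambda>y. ?F b + t < ?F y \<and> b \<le> y) at_top"
      using eventually_ge_at_top by (rule eventually_conj)
    then obtain y where y: "?F b + t < ?F y" "b \<le> y"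
      by (auto dest: eventually_happens)
    then obtain q where q: "b \<le> q" "?F q = ?F b + t"
      using IVT'[of ?F b "?F b + t" y] t atomless_isCont_cdf[OF \<nu>]
      by (metis add.right_neutral add_left_mono continuous_at_imp_continuous_on less_imp_le)
    have "measure \<nu> {b<..q} = t"
      using q cdf_diff_eq[of b q] t by (cases "b = q") auto
    then show ?thesis by (intro that[of "{b<..q}"]) auto
  qed
qed

text \<open>Reflection preserves the absence of atoms, so the two preceding constructions at upper
  ends also serve lower ends.\<close>

lemma atomless_flip:
  fixes \<nu> :: "real measure"
  assumes "prob_space \<nu>" "sets \<nu> = sets borel" "\<And>x. measure \<nu> {x} = 0"
  shows "prob_space (distr \<nu> borel (flip s))" "measure (distr \<nu> borel (flip s)) {x} = 0"
    "A \<in> sets borel \<Longrightarrow> measure (distr \<nu> borel (flip s)) A = measure \<nu> {x. flip s x \<in> A}"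
proof -
  have [measurable]: "flip s \<in> measurable \<nu> borel"
    using assms(2) flip_measurable by (simp cong: measurable_cong_sets)
  have sp: "space \<nu> = UNIV" using sets_eq_imp_space_eq[OF assms(2)] by simp
  show "prob_space (distr \<nu> borel (flip s))"
    by (intro prob_space.prob_space_distr assms(1)) simp
  show *: "measure (distr \<nu> borel (flip s)) A = measure \<nu> {x. flip s x \<in> A}" if "A \<in> sets borel" for A
    using that by (subst measure_distr) (auto simp: sp vimage_def)
  have "{y. flip s y = x} = {flip s x}" by (auto simp: flip_def)
  then show "measure (distr \<nu> borel (flip s)) {x} = 0"
    using assms(3) by (subst *) simp_all
qed

section \<open>Product sets under a product distribution\<close>

lemma measure_product_distribution:
  fixes \<mu> :: "(real^'k) measure"
  assumes "prob_space \<mu>" and sets: "sets \<mu> = sets borel" and prod: "product_distribution \<mu>"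
    and A: "\<And>j. A j \<in> sets borel"
  shows "measure \<mu> {x. \<forall>j. x $ j \<in> A j} = (\<Prod>j\<in>UNIV. measure (coord_marginal \<mu> j) (A j))"
proof -
  have nth [measurable]: "(\<lambda>x::real^'k. x $ j) \<in> borel_measurable borel" for j
    by (intro borel_measurable_continuous_onI continuous_intros)
  have pm: "prob_space (coord_marginal \<mu> j)" for j
    unfolding coord_marginal_def
    by (intro prob_space.prob_space_distr assms(1)) (simp add: sets nth cong: measurable_cong_sets)
  interpret P: finite_product_prob_space "coord_marginal \<mu>" UNIV
    by (intro finite_product_prob_space.intro product_prob_spaceI finite_product_sigma_finite.intro
        product_sigma_finite.intro finite_product_sigma_finite_axioms.intro finite
        prob_space_imp_sigma_finite pm)
  have vl: "vec_lambda \<in> measurable (\<Pi>\<^sub>M j\<in>UNIV. coord_marginal \<mu> j) (borel :: (real^'k) measure)"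
  proof (subst borel_measurable_euclidean_space, intro ballI)
    fix i :: "real^'k" assume "i \<in> Basis"
    then obtain j where "i = axis j 1" by (auto simp: Basis_vec_def)
    then have "(\<lambda>f. vec_lambda f \<bullet> i) = (\<lambda>f. f j)" by (simp add: inner_axis)
    moreover have "(\<lambda>f. f j) \<in> borel_measurable (\<Pi>\<^sub>M j\<in>UNIV. coord_marginal \<mu> j)"
      using measurable_component_singleton[of j UNIV "coord_marginal \<mu>"]
      by (subst measurable_cong_sets[OF refl, of borel "coord_marginal \<mu> j"])
        (simp_all add: coord_marginal_def)
    ultimately show "(\<lambda>f. vec_lambda f \<bullet> i) \<in> borel_measurable (\<Pi>\<^sub>M j\<in>UNIV. coord_marginal \<mu> j)"
      by simp
  qed
  have meas: "{x::real^'k. \<forall>j. x $ j \<in> A j} \<in> sets borel"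
    using A by measurable
  have sp: "space (\<Pi>\<^sub>M j\<in>UNIV. coord_marginal \<mu> j) = UNIV"
    by (auto simp: space_PiM coord_marginal_def)
  have "measure \<mu> {x. \<forall>j. x $ j \<in> A j} =
        measure (\<Pi>\<^sub>M j\<in>UNIV. coord_marginal \<mu> j) (Pi\<^sub>E UNIV A)"
    by (subst prod[unfolded product_distribution_def], subst measure_distr[OF vl meas])
      (auto simp: sp intro!: arg_cong2[where f=measure])
  also have "\<dots> = (\<Prod>j\<in>UNIV. measure (coord_marginal \<mu> j) (A j))"
    using A by (intro P.finite_measure_PiM_emb) (simp add: coord_marginal_def)
  finally show ?thesis .
qed

section \<open>Independent samples\<close>

text \<open>Common source of both tail estimates, with \<open>g\<close> equal to one minus or one
  plus the indicator of a set.\<close>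

lemma (in prob_space) iid_expectation_prod:
  fixes g :: "'z \<Rightarrow> real"
  assumes iid: "iid_sequence M P Z" and g: "g \<in> borel_measurable P" and bd: "\<And>z. norm (g z) \<le> B"
  shows "expectation (\<lambda>\<omega>. \<Prod>i=1..m. g (Z i \<omega>)) = (\<integral>z. g z \<partial>P) ^ m"
    and "integrable M (\<lambda>\<omega>. \<Prod>i=1..m. g (Z i \<omega>))"
proof -
  have ind: "indep_vars (\<lambda>_. P) Z {1..m}" and D: "\<And>i. i \<ge> 1 \<Longrightarrow> distr M P (Z i) = P"
    using iid indep_vars_subset[of "\<lambda>_. P" Z "{1..}" "{1..m}"] by (auto simp: iid_sequence_def)
  have ind': "indep_vars (\<lambda>_. borel) (\<lambda>i \<omega>. g (Z i \<omega>)) {1..m}"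
    using indep_vars_compose2[OF ind, of "\<lambda>_. g" "\<lambda>_. borel"] g by simp
  have Zm: "Z i \<in> measurable M P" if "i \<in> {1..m}" for i
    using ind that by (auto simp: indep_vars_def)
  have int: "integrable M (\<lambda>\<omega>. g (Z i \<omega>))" if "i \<in> {1..m}" for i
    using Zm[OF that] g bd by (intro integrable_const_bound[where B=B]) auto
  have eq: "expectation (\<lambda>\<omega>. g (Z i \<omega>)) = (\<integral>z. g z \<partial>P)" if "i \<in> {1..m}" for i
    using integral_distr[OF Zm[OF that] g] D[of i] that by simp
  show "expectation (\<lambda>\<omega>. \<Prod>i=1..m. g (Z i \<omega>)) = (\<integral>z. g z \<partial>P) ^ m"
    using indep_vars_lebesgue_integral[OF _ ind' int] by (simp add: eq)
  show "integrable M (\<lambda>\<omega>. \<Prod>i=1..m. g (Z i \<omega>))"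
    using indep_vars_integrable[OF _ ind' int] by simp
qed

text \<open>The product of the factors \<open>1 - indicator A (Z i \<omega>)\<close> is the
  indicator of missing \<open>A\<close> throughout, so the probability is
  \<open>(1 - measure P A) ^ m\<close>.\<close>

lemma (in prob_space) iid_prob_avoid:
  assumes iid: "iid_sequence M P Z" and P: "prob_space P" and A: "A \<in> sets P"
  shows "prob {\<omega> \<in> space M. \<forall>i\<in>{1..m}. Z i \<omega> \<notin> A} \<le> exp (- (real m * measure P A))"
proof -
  interpret P: prob_space P by fact
  let ?E = "{\<omega> \<in> space M. \<forall>i\<in>{1..m}. Z i \<omega> \<notin> A}"
  have [measurable]: "Z i \<in> measurable M P" if "i \<in> {1..m}" for i
    using iid that by (auto simp: iid_sequence_def indep_vars_def)
  have "(\<Prod>i=1..m. 1 - indicator A (Z i \<omega>)) = (indicator ?E \<omega> :: real)" if "\<omega> \<in> space M" for \<omega>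
    using that by (auto simp: indicator_def intro!: prod.neutral prod_zero)
  then have "expectation (\<lambda>\<omega>. \<Prod>i=1..m. 1 - indicator A (Z i \<omega>)) = expectation (indicat_real ?E)"
    by (intro Bochner_Integration.integral_cong refl)
  also have "\<dots> = prob ?E" by (auto intro!: arg_cong[where f=prob])
  finally have "prob ?E = (\<integral>z. 1 - indicator A z \<partial>P) ^ m"
    using iid_expectation_prod(1)[OF iid, of "\<lambda>z. 1 - indicator A z" 1 m] A by (simp add: indicator_def)
  also have "(\<integral>z. 1 - indicator A z \<partial>P) = 1 - measure P A"
    using A by (subst Bochner_Integration.integral_diff)
      (simp_all add: P.prob_space integrable_real_indicator P.emeasure_finite less_top[symmetric])
  also have "(1 - measure P A) ^ m \<le> exp (- measure P A) ^ m"
    using exp_ge_add_one_self[of "- measure P A"] by (intro power_mono) auto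
  finally show ?thesis by (simp add: exp_of_nat_mult[symmetric])
qed

text \<open>Exponential Markov inequality with base 2, since \<open>E 2^N = (1 + P A)^m\<close>.\<close>

lemma (in prob_space) iid_prob_count_ge:
  assumes iid: "iid_sequence M P Z" and P: "prob_space P" and A: "A \<in> sets P"
  shows "prob {\<omega> \<in> space M. K \<le> real (card {i\<in>{1..m}. Z i \<omega> \<in> A})} \<le> exp (real m * measure P A) / 2 powr K"
proof -
  interpret P: prob_space P by fact
  let ?N = "\<lambda>\<omega>. card {i\<in>{1..m}. Z i \<omega> \<in> A}"
  have N: "(\<Prod>i=1..m. 1 + indicator A (Z i \<omega>)) = (2 powr real (?N \<omega>) :: real)" for \<omega>
  proof -
    have "(\<Prod>i=1..m. 1 + indicator A (Z i \<omega>)) = (\<Prod>i=1..m. if Z i \<omega> \<in> A then 2 else 1 :: real)"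
      by (intro prod.cong) auto
    also have "\<dots> = 2 ^ ?N \<omega>" by (simp add: prod.If_cases Int_def)
    finally show ?thesis by (simp add: powr_realpow)
  qed
  have g: "(\<lambda>z. 1 + indicator A z :: real) \<in> borel_measurable P" using A by simp
  note E = iid_expectation_prod[OF iid g, of 2 m, unfolded N]
  have int: "integrable M (\<lambda>\<omega>. 2 powr real (?N \<omega>))"
    by (rule E(2)) (auto simp: indicator_def)
  have "prob {\<omega> \<in> space M. K \<le> real (?N \<omega>)} = prob {\<omega> \<in> space M. 2 powr K \<le> 2 powr real (?N \<omega>)}"
    by simp
  also have "\<dots> \<le> expectation (\<lambda>\<omega>. 2 powr real (?N \<omega>)) / 2 powr K"
    using int by (intro integral_Markov_inequality_measure[where A="{}"]) auto
  also have "expectation (\<lambda>\<omega>. 2 powr real (?N \<omega>)) = (\<integral>z. 1 + indicator A z \<partial>P) ^ m"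
    by (rule E(1)) (auto simp: indicator_def)
  also have "(\<integral>z. 1 + indicator A z \<partial>P) = 1 + measure P A"
    using A by (subst Bochner_Integration.integral_add)
      (simp_all add: P.prob_space integrable_real_indicator P.emeasure_finite less_top[symmetric])
  also have "(1 + measure P A) ^ m \<le> exp (measure P A) ^ m"
    by (intro power_mono) auto
  finally show ?thesis by (simp add: exp_of_nat_mult divide_right_mono)
qed

section \<open>Strips and slabs of a product distribution\<close>

text \<open>All three bounds come from one-dimensional cuts. A strip shrinks one side of the box to
  a fraction \<open>1 / (8k)\<close>, a slab replaces one side by an outer interval and trims the
  remaining sides slightly, and the near region is a union of \<open>2k\<close> sets of mass at most
  \<open>t\<close>.\<close>

lemma ex_strips_and_slabs:
  fixes Q :: "(real^'k) measure" and a b :: "real^'k" and t lam :: real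
  defines "\<beta> \<equiv> \<lambda>j s. flip s (if s then b $ j else a $ j)"
  assumes Q: "prob_space Q" "sets Q = sets borel" "product_distribution Q"
    and atomless: "\<And>j x. measure (coord_marginal Q j) {x} = 0"
    and lam: "0 < lam" "lam \<le> measure Q (cbox a b)" and t: "0 \<le> t"
  obtains \<gamma> U where
    "\<And>j s. U j s \<in> sets borel" "\<And>j s. U j s \<subseteq> {\<beta> j s<..}"
    "\<And>j s u v. u \<in> U j s \<Longrightarrow> \<beta> j s < v \<Longrightarrow> v \<notin> U j s \<Longrightarrow> u \<le> v"
    "\<And>j s. lam / (8 * real CARD('k)) \<le> measure Q {x. x \<in> cbox a b \<and> \<gamma> j s \<le> flip s (x $ j)}"
    "\<And>j s. U j s = {\<beta> j s<..} \<or> 3 / 4 * t * lam \<le>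
       measure Q {x. flip s (x $ j) \<in> U j s \<and> (\<forall>i s'. i \<noteq> j \<longrightarrow> flip s' (x $ i) \<le> \<gamma> i s')}"
    "measure Q {x. \<exists>j s. flip s (x $ j) \<in> U j s} \<le> 2 * real CARD('k) * t"
proof -
  interpret Q: prob_space Q by fact
  define \<nu> where "\<nu> = coord_marginal Q"
  define e :: real where "e = 1 / (8 * real CARD('k))"
  have k1: "1 \<le> real CARD('k)" using zero_less_card_finite[where 'a='k] by linarith
  have "e \<le> 1 / 8"
    unfolding e_def using k1 by (intro divide_left_mono) linarith+
  moreover have "0 \<le> e" by (simp add: e_def)
  ultimately have e: "0 \<le> e" "e \<le> 1" "2 * e \<le> 1"
    by linarith+
  have nth [measurable]: "(\<lambda>x::real^'k. x $ j) \<in> borel_measurable borel" for j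
    by (intro borel_measurable_continuous_onI continuous_intros)
  have nthQ: "(\<lambda>x. x $ j) \<in> borel_measurable Q" for j
    using nth by (simp add: Q(2) cong: measurable_cong_sets)
  have \<nu>: "prob_space (\<nu> j)" "sets (\<nu> j) = sets borel" "measure (\<nu> j) {x} = 0" for j x
    using atomless nthQ by (auto simp: \<nu>_def coord_marginal_def intro: Q.prob_space_distr)
  have prod: "measure Q {x. \<forall>j. x $ j \<in> A j} = (\<Prod>j\<in>UNIV. measure (\<nu> j) (A j))"
    if "\<And>j. A j \<in> sets borel" for A
    unfolding \<nu>_def using measure_product_distribution[OF Q that] .
  define len where "len j = measure (\<nu> j) {a $ j..b $ j}" for j
  have len: "0 \<le> len j" "len j \<le> 1" for j
    using prob_space.prob_le_1[OF \<nu>(1)] by (auto simp: len_def)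
  have "cbox a b = {x. \<forall>j. x $ j \<in> {a $ j..b $ j}}" by (auto simp: mem_box_cart)
  then have lam_len: "lam \<le> (\<Prod>j\<in>UNIV. len j)"
    using lam(2) prod[of "\<lambda>j. {a $ j..b $ j}"] by (simp add: len_def)
  have ab: "a $ j \<le> b $ j" for j
  proof (rule ccontr)
    assume "\<not> a $ j \<le> b $ j"
    then have "cbox a b = {}" by (auto simp: mem_box_cart) (meson order_trans)
    then show False using lam by simp
  qed
  \<comment> \<open>The face opposite to \<open>\<beta> j s\<close>, in the same orientation: after
    flipping, side \<open>j\<close> of the box is the interval from \<open>\<alpha> j s\<close> to
    \<open>\<beta> j s\<close>.\<close>
  define \<alpha> where "\<alpha> j s = flip s (if s then a $ j else b $ j)" for j s
  have \<alpha>\<beta>: "\<alpha> j s \<le> \<beta> j s" and between: "{y. \<alpha> j s \<le> flip s y \<and> flip s y \<le> \<beta> j s} = {a $ j..b $ j}" for j s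
    using ab by (auto simp: \<alpha>_def \<beta>_def flip_def)
  have "\<exists>c. \<alpha> j s \<le> c \<and> c \<le> \<beta> j s \<and> measure (\<nu> j) {y. c \<le> flip s y \<and> flip s y \<le> \<beta> j s} = e * len j" for j s
  proof -
    note fl = atomless_flip[where \<nu>="\<nu> j" and s=s, OF \<nu>]
    obtain c where "\<alpha> j s \<le> c" "c \<le> \<beta> j s"
      "measure (distr (\<nu> j) borel (flip s)) {c..\<beta> j s} = e * measure (distr (\<nu> j) borel (flip s)) {\<alpha> j s..\<beta> j s}"
      using ex_upper_tail_point[OF fl(1) _ fl(2) \<alpha>\<beta> e(1,2)] by auto
    then show ?thesis by (auto simp: fl(3) between len_def)
  qed
  then obtain \<gamma> where \<gamma>: "\<alpha> j s \<le> \<gamma> j s" "\<gamma> j s \<le> \<beta> j s"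
    "measure (\<nu> j) {y. \<gamma> j s \<le> flip s y \<and> flip s y \<le> \<beta> j s} = e * len j" for j s
    by metis
  have "\<exists>V. V \<in> sets borel \<and> V \<subseteq> {\<beta> j s<..} \<and> (\<forall>u v. u \<in> V \<longrightarrow> \<beta> j s < v \<longrightarrow> v \<notin> V \<longrightarrow> u \<le> v) \<and>
     measure (\<nu> j) {y. flip s y \<in> V} \<le> t \<and> (V = {\<beta> j s<..} \<or> measure (\<nu> j) {y. flip s y \<in> V} = t)" for j s
  proof -
    note fl = atomless_flip[where \<nu>="\<nu> j" and s=s, OF \<nu>]
    obtain V where V: "V \<in> sets borel" "V \<subseteq> {\<beta> j s<..}"
      "\<And>u v. u \<in> V \<Longrightarrow> \<beta> j s < v \<Longrightarrow> v \<notin> V \<Longrightarrow> u \<le> v"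
      "measure (distr (\<nu> j) borel (flip s)) V \<le> t"
      "V = {\<beta> j s<..} \<or> measure (distr (\<nu> j) borel (flip s)) V = t"
      using ex_outer_interval[OF fl(1) _ fl(2) t, of "\<beta> j s"] by auto
    then show ?thesis unfolding fl(3)[OF V(1)] by blast
  qed
  then have "\<forall>j s. \<exists>V. V \<in> sets borel \<and> V \<subseteq> {\<beta> j s<..} \<and> (\<forall>u v. u \<in> V \<longrightarrow> \<beta> j s < v \<longrightarrow> v \<notin> V \<longrightarrow> u \<le> v) \<and>
     measure (\<nu> j) {y. flip s y \<in> V} \<le> t \<and> (V = {\<beta> j s<..} \<or> measure (\<nu> j) {y. flip s y \<in> V} = t)"
    by blast
  then obtain U where "\<forall>j s. U j s \<in> sets borel \<and> U j s \<subseteq> {\<beta> j s<..} \<and>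
     (\<forall>u v. u \<in> U j s \<longrightarrow> \<beta> j s < v \<longrightarrow> v \<notin> U j s \<longrightarrow> u \<le> v) \<and>
     measure (\<nu> j) {y. flip s y \<in> U j s} \<le> t \<and>
     (U j s = {\<beta> j s<..} \<or> measure (\<nu> j) {y. flip s y \<in> U j s} = t)"
    unfolding choice_iff by blast
  then have U [measurable]: "U j s \<in> sets borel" and U': "U j s \<subseteq> {\<beta> j s<..}"
     "u \<in> U j s \<Longrightarrow> \<beta> j s < v \<Longrightarrow> v \<notin> U j s \<Longrightarrow> u \<le> v"
     "measure (\<nu> j) {y. flip s y \<in> U j s} \<le> t"
     "U j s = {\<beta> j s<..} \<or> measure (\<nu> j) {y. flip s y \<in> U j s} = t" for j s u v
    by blast+
  show ?thesis
  proof (rule that[of U \<gamma>])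
    fix j s
    let ?B = "\<lambda>i. if i = j then {y. \<gamma> j s \<le> flip s y \<and> flip s y \<le> \<beta> j s} else {a $ i..b $ i}"
    have "{x. x \<in> cbox a b \<and> \<gamma> j s \<le> flip s (x $ j)} = {x. \<forall>i. x $ i \<in> ?B i}" (is "?l = ?r")
    proof (intro set_eqI iffI)
      fix x assume "x \<in> ?l"
      moreover from this have "flip s (x $ j) \<le> \<beta> j s" unfolding \<beta>_def using mem_cbox_flip by blast
      ultimately show "x \<in> ?r" by (auto simp: mem_box_cart)
    next
      fix x assume x: "x \<in> ?r"
      then have xj: "\<gamma> j s \<le> flip s (x $ j)" "flip s (x $ j) \<le> \<beta> j s" by (auto dest: spec[of _ j])
      then have "x $ j \<in> {y. \<alpha> j s \<le> flip s y \<and> flip s y \<le> \<beta> j s}" using \<gamma>(1)[of j s] by simp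
      then have "x $ j \<in> {a $ j..b $ j}" unfolding between .
      then have "x $ i \<in> {a $ i..b $ i}" for i
        using x by (cases "i = j") (auto dest: spec[of _ i])
      then show "x \<in> ?l" using xj by (auto simp: mem_box_cart)
    qed
    then have "measure Q {x. x \<in> cbox a b \<and> \<gamma> j s \<le> flip s (x $ j)} = (\<Prod>i\<in>UNIV. measure (\<nu> i) (?B i))"
      by (simp only:) (rule prod, auto)
    also have "\<dots> = measure (\<nu> j) (?B j) * (\<Prod>i\<in>UNIV - {j}. measure (\<nu> i) (?B i))"
      by (rule prod.remove) auto
    also have "(\<Prod>i\<in>UNIV - {j}. measure (\<nu> i) (?B i)) = (\<Prod>i\<in>UNIV - {j}. len i)"
      by (intro prod.cong) (auto simp: len_def)
    also have "measure (\<nu> j) (?B j) = e * len j" using \<gamma>(3) by simp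
    \<comment> \<open>Only side \<open>j\<close> was shortened, so the strip carries exactly the
      fraction \<open>e\<close> of the mass of the box.\<close>
    also have "e * len j * (\<Prod>i\<in>UNIV - {j}. len i) = e * (\<Prod>i\<in>UNIV. len i)"
      by (subst prod.remove[of UNIV j len]) auto
    also have "\<dots> \<ge> e * lam" using lam_len e(1) by (intro mult_left_mono)
    finally show "lam / (8 * real CARD('k)) \<le> measure Q {x. x \<in> cbox a b \<and> \<gamma> j s \<le> flip s (x $ j)}"
      by (simp add: e_def)
  next
    fix j s
    show "U j s = {\<beta> j s<..} \<or> 3 / 4 * t * lam \<le>
       measure Q {x. flip s (x $ j) \<in> U j s \<and> (\<forall>i s'. i \<noteq> j \<longrightarrow> flip s' (x $ i) \<le> \<gamma> i s')}"
    proof (cases "U j s = {\<beta> j s<..}")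
      case False
      define mid where "mid i = {y. \<forall>s'. flip s' y \<le> \<gamma> i s'}" for i
      have mid_sets [measurable]: "mid i \<in> sets borel" for i
        unfolding mid_def by measurable
      have mid: "(1 - 2 * e) * len i \<le> measure (\<nu> i) (mid i)" for i
      proof -
        interpret prob_space "\<nu> i" by (rule \<nu>)
        let ?E = "\<lambda>s. {y. \<gamma> i s \<le> flip s y \<and> flip s y \<le> \<beta> i s}"
        have meas: "mid i \<in> events" "?E s \<in> events" for s by (auto simp: \<nu>(2))
        \<comment> \<open>Side \<open>i\<close> is covered by its middle part and its two end
          strips. Each strip has mass \<open>e * len i\<close>, so the middle retains a fraction of
          at least \<open>1 - 2 * e\<close>.\<close>
        have "{a $ i..b $ i} \<subseteq> mid i \<union> (?E True \<union> ?E False)"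
        proof
          fix y assume "y \<in> {a $ i..b $ i}"
          then have "flip s y \<le> \<beta> i s" for s by (auto simp: \<beta>_def flip_def)
          then show "y \<in> mid i \<union> (?E True \<union> ?E False)"
            unfolding mid_def by (auto simp: all_bool_eq)
        qed
        then have "len i \<le> prob (mid i \<union> (?E True \<union> ?E False))"
          unfolding len_def using meas by (intro finite_measure_mono) auto
        also have "\<dots> \<le> prob (mid i) + (prob (?E True) + prob (?E False))"
          using meas measure_Un_le order_trans add_left_mono by (meson sets.Un)
        finally show ?thesis using \<gamma>(3)[of i] by (simp add: algebra_simps)
      qed
      let ?B = "\<lambda>i. if i = j then {y. flip s y \<in> U j s} else mid i"
      have "{x. flip s (x $ j) \<in> U j s \<and> (\<forall>i s'. i \<noteq> j \<longrightarrow> flip s' (x $ i) \<le> \<gamma> i s')} = {x. \<forall>i. x $ i \<in> ?B i}"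
        by (auto simp: mid_def split: if_splits)
      then have "measure Q {x. flip s (x $ j) \<in> U j s \<and> (\<forall>i s'. i \<noteq> j \<longrightarrow> flip s' (x $ i) \<le> \<gamma> i s')} =
          (\<Prod>i\<in>UNIV. measure (\<nu> i) (?B i))"
        by (simp only:) (rule prod, auto)
      also have "\<dots> = measure (\<nu> j) (?B j) * (\<Prod>i\<in>UNIV - {j}. measure (\<nu> i) (?B i))"
        by (rule prod.remove) auto
      also have "(\<Prod>i\<in>UNIV - {j}. measure (\<nu> i) (?B i)) = (\<Prod>i\<in>UNIV - {j}. measure (\<nu> i) (mid i))"
        by (intro prod.cong) auto
      also have "measure (\<nu> j) (?B j) = t" using U'(4)[of j s] False by simp
      finally have eq: "measure Q {x. flip s (x $ j) \<in> U j s \<and> (\<forall>i s'. i \<noteq> j \<longrightarrow> flip s' (x $ i) \<le> \<gamma> i s')} =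
          t * (\<Prod>i\<in>UNIV - {j}. measure (\<nu> i) (mid i))" .
      \<comment> \<open>With \<open>e = 1 / (8k)\<close>, trimming \<open>k - 1\<close> sides costs
        at most \<open>(k - 1) / (4k)\<close>, which is below \<open>1 / 4\<close>; Bernoulli's
        inequality passes to the product.\<close>
      have "3 / 4 \<le> 1 + real (CARD('k) - 1) * (- (2 * e))"
        using k1 by (simp add: e_def of_nat_diff field_simps)
      also have "\<dots> \<le> (1 + - (2 * e)) ^ (CARD('k) - 1)"
        using e(3) by (intro Bernoulli_inequality) simp
      finally have bern: "3 / 4 \<le> (1 - 2 * e) ^ (CARD('k) - 1)" by simp
      \<comment> \<open>The slab does not use side \<open>j\<close> of the box; dropping its factor
        \<open>len j\<close>, at most 1, keeps the lower bound \<open>lam\<close>.\<close>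
      have "lam \<le> len j * (\<Prod>i\<in>UNIV - {j}. len i)"
        using lam_len by (subst (asm) prod.remove[of UNIV j len]) auto
      also have "\<dots> \<le> 1 * (\<Prod>i\<in>UNIV - {j}. len i)"
        using len by (intro mult_right_mono prod_nonneg) auto
      finally have "lam \<le> (\<Prod>i\<in>UNIV - {j}. len i)" by simp
      then have "3 / 4 * lam \<le> (1 - 2 * e) ^ (CARD('k) - 1) * (\<Prod>i\<in>UNIV - {j}. len i)"
        using bern lam by (intro mult_mono) auto
      also have "\<dots> = (\<Prod>i\<in>UNIV - {j}. (1 - 2 * e) * len i)"
        by (simp add: prod.distrib card_Diff_singleton)
      also have "\<dots> \<le> (\<Prod>i\<in>UNIV - {j}. measure (\<nu> i) (mid i))"
        using mid len e(3) by (intro prod_mono) auto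
      finally have "t * (3 / 4 * lam) \<le> t * (\<Prod>i\<in>UNIV - {j}. measure (\<nu> i) (mid i))"
        using t by (intro mult_left_mono)
      then show ?thesis unfolding eq by (simp add: algebra_simps)
    qed simp
  next
    have *: "measure Q {x. flip s (x $ j) \<in> U j s} \<le> t" for j s
    proof -
      have "measure Q {x. flip s (x $ j) \<in> U j s} = measure (\<nu> j) {y. flip s y \<in> U j s}"
        unfolding \<nu>_def coord_marginal_def using sets_eq_imp_space_eq[OF Q(2)]
        by (subst measure_distr[OF nthQ]) (auto simp: vimage_def)
      then show ?thesis using U'(3)[of j s] by simp
    qed
    let ?V = "\<lambda>p. {x. flip (snd p) (x $ fst p) \<in> U (fst p) (snd p)}"
    have "{x. \<exists>j s. flip s (x $ j) \<in> U j s} = \<Union>(range ?V)"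
      by auto blast
    then have "measure Q {x. \<exists>j s. flip s (x $ j) \<in> U j s} \<le> (\<Sum>p\<in>UNIV. measure Q (?V p))"
      by (simp only:) (intro measure_UNION_le; simp add: Q(2))
    also have "\<dots> \<le> (\<Sum>p\<in>(UNIV :: ('k \<times> bool) set). t)"
      using * by (intro sum_mono)
    also have "\<dots> = 2 * real CARD('k) * t" by (simp add: card_UNIV_bool)
    finally show "measure Q {x. \<exists>j s. flip s (x $ j) \<in> U j s} \<le> 2 * real CARD('k) * t" .
  qed (use U U' in auto)
qed

section \<open>Correct labels under realizability\<close>

lemma space_example_space: "space example_space = UNIV \<times> labels"
  by (simp add: example_space_def space_pair_measure)

text \<open>The target is constant on the box and on its complement. On each piece the correct label
  has conditional probability 1, so the two correctly labelled pieces together carry the full mass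
  of the marginal.\<close>

lemma realizable_by_rectangle_null:
  fixes P :: "((real^'k) \<times> int) measure"
  assumes P: "prob_space P" and sets: "sets P = sets example_space"
    and real: "realizable_by P (rectangle a b)"
  shows "measure P {z \<in> space P. snd z \<noteq> rectangle a b (fst z)} = 0"
    and "{z \<in> space P. snd z \<noteq> rectangle a b (fst z)} \<in> sets P"
proof -
  interpret prob_space P by fact
  obtain K where K: "K \<in> measurable borel (prob_algebra (count_space labels))"
    "\<And>A B. A \<in> sets borel \<Longrightarrow> B \<subseteq> labels \<Longrightarrow>
        emeasure P (A \<times> B) = (\<integral>\<^sup>+x\<in>A. emeasure (K x) B \<partial>marginal_X P)"
    and K1: "\<And>x. measure (K x) {rectangle a b x} = 1"
    using real unfolding realizable_by_def conditional_label_distribution_def by blast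
  have sp: "space P = UNIV \<times> labels"
    using sets_eq_imp_space_eq[OF sets] by (simp add: space_example_space)
  have fst: "fst \<in> measurable P borel"
    by (simp add: measurable_cong_sets[OF sets refl] example_space_def)
  have *: "emeasure P (A \<times> {c}) = emeasure (marginal_X P) A"
    if A: "A \<in> sets borel" and c: "c \<in> labels" "\<And>x. x \<in> A \<Longrightarrow> rectangle a b x = c" for A c
  proof -
    have "emeasure (K x) {c} = 1" if "x \<in> A" for x
    proof -
      \<comment> \<open>An infinite \<open>emeasure\<close> would give \<open>measure\<close> the
        value 0, so the value 1 transfers to \<open>emeasure\<close>.\<close>
      have "measure (K x) {c} = 1" using K1[of x] c(2)[OF that] by simp
      then show ?thesis
        by (metis emeasure_eq_ennreal_measure ennreal_1 measure_def enn2real_top zero_neq_one)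
    qed
    then have "emeasure P (A \<times> {c}) = (\<integral>\<^sup>+x. indicator A x \<partial>marginal_X P)"
      using K(2)[OF A, of "{c}"] c(1) by (auto intro!: nn_integral_cong simp: indicator_def)
    also have "\<dots> = emeasure (marginal_X P) A"
      using A by (simp add: marginal_X_def)
    finally show ?thesis .
  qed
  let ?A = "cbox a b"
  have 1: "emeasure P (?A \<times> {1}) = emeasure (marginal_X P) ?A"
    "emeasure P ((- ?A) \<times> {-1}) = emeasure (marginal_X P) (- ?A)"
    by (rule *; auto simp: labels_def rectangle_conv_cbox)+
  have G: "{z \<in> space P. snd z = rectangle a b (fst z)} = ?A \<times> {1} \<union> (- ?A) \<times> {-1}"
    by (auto simp: sp labels_def rectangle_conv_cbox split: if_splits)
  have meas: "?A \<times> {1} \<in> sets P" "(- ?A) \<times> {-1} \<in> sets P"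
    unfolding sets example_space_def by (auto intro!: pair_measureI simp: labels_def)
  have "emeasure P {z \<in> space P. snd z = rectangle a b (fst z)} =
        emeasure (marginal_X P) ?A + emeasure (marginal_X P) (- ?A)"
    unfolding G using meas by (subst plus_emeasure[symmetric]) (auto simp: 1)
  also have "\<dots> = emeasure (marginal_X P) UNIV"
    by (subst plus_emeasure) (auto simp: marginal_X_def Un_commute)
  also have "\<dots> = 1"
    using prob_space.emeasure_space_1[OF prob_space_distr[OF fst]] by (simp add: marginal_X_def)
  finally have "prob {z \<in> space P. snd z = rectangle a b (fst z)} = 1"
    by (simp add: measure_def)
  moreover have "{z \<in> space P. snd z = rectangle a b (fst z)} \<in> events"
    unfolding G using meas by blast
  moreover have "{z \<in> space P. snd z \<noteq> rectangle a b (fst z)} =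
      space P - {z \<in> space P. snd z = rectangle a b (fst z)}"
    by auto
  ultimately show "measure P {z \<in> space P. snd z \<noteq> rectangle a b (fst z)} = 0"
    "{z \<in> space P. snd z \<noteq> rectangle a b (fst z)} \<in> sets P"
    by (simp_all add: prob_compl)
qed

section \<open>The tail bound\<close>

theorem theorem13:
  fixes P :: "((real^'k) \<times> int) measure"
    and M :: "'w measure"
    and Z :: "nat \<Rightarrow> 'w \<Rightarrow> (real^'k) \<times> int"
    and fstar :: "real^'k \<Rightarrow> int"
    and m :: nat
    and lam \<delta> :: real
  assumes "m \<ge> 1"
    and "0 < lam" "lam < 1"
    and "0 < \<delta>" "\<delta> < 1"
    and "prob_space P"
    and "sets P = sets example_space"
    and "product_distribution (marginal_X P)"
    and "\<And>j. continuous_on UNIV (cdf (coord_marginal (marginal_X P) j))"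
    and "fstar \<in> rectangle_class P lam"
    and "realizable_by P fstar"
    and "prob_space M"
    and "iid_sequence M P Z"
  shows "real (B_n_hat M (rectangle_class P lam) Z m \<delta>)
           \<le> 8 * real CARD('k) / lam * ln (8 * real CARD('k) / \<delta>)"
proof -
  interpret P: prob_space P by fact
  interpret M: prob_space M by fact
  define Q where "Q = marginal_X P"
  define k where "k = real CARD('k)"
  define L where "L = ln (8 * k / \<delta>)"
  \<comment> \<open>The claimed bound is \<open>8 * R\<close>. Of this, \<open>R\<close> pays for
    the \<open>2k\<close> extremal points and \<open>7 * R\<close> for the near points.\<close>
  define R where "R = k * L / lam"
  define F where "F = rectangle_class P lam"
  have goal: "8 * real CARD('k) / lam * ln (8 * real CARD('k) / \<delta>) = 8 * R"
    by (simp add: R_def L_def k_def)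
  have k: "1 \<le> k" unfolding k_def using zero_less_card_finite[where 'a='k] by linarith
  have "8 * k / \<delta> \<ge> 8 * k / 1" using assms(4,5) k by (intro divide_left_mono) auto
  then have "8 \<le> 8 * k / \<delta>" using k by linarith
  \<comment> \<open>\<open>ln 8 = 3 * ln 2\<close> is at least 2. The resulting
    \<open>2 \<le> L\<close> is what makes \<open>2 * k \<le> R\<close>.\<close>
  then have "ln 8 \<le> L" unfolding L_def by (subst ln_le_cancel_iff) auto
  moreover have "ln (8::real) = 3 * ln 2" using ln_realpow[of 2 3] by simp
  ultimately have L: "2 \<le> L" using ln2_ge_two_thirds by linarith
  have exp_L: "exp (- L) = \<delta> / (8 * k)"
    using k assms(4) by (simp add: L_def exp_minus field_simps)
  have kL: "k * L \<le> R"
    unfolding R_def using assms(2,3) k L by (simp add: pos_le_divide_eq)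
  have kR: "2 * k \<le> R" using kL mult_left_mono[OF L, of k] k by linarith
  have LR: "L \<le> R" using kL mult_right_mono[OF k, of L] L by linarith
  have fst: "fst \<in> measurable P borel"
    by (simp add: measurable_cong_sets[OF assms(7) refl] example_space_def)
  have Q: "prob_space Q" "sets Q = sets borel"
    unfolding Q_def marginal_X_def using P.prob_space_distr[OF fst] by auto
  interpret Q: prob_space Q by (rule Q)
  have Q_eq: "measure Q A = P.prob {z \<in> space P. fst z \<in> A}" "{z \<in> space P. fst z \<in> A} \<in> P.events"
    if "A \<in> sets borel" for A
    using measurable_sets[OF fst that] that unfolding Q_def marginal_X_def
    by (subst measure_distr[OF fst], auto simp: vimage_def Int_def conj_commute)
  have coord: "real_distribution (coord_marginal Q j)" for j
  proof -
    have "(\<lambda>x::real^'k. x $ j) \<in> borel_measurable borel"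
      by (intro borel_measurable_continuous_onI continuous_intros)
    then have "(\<lambda>x. x $ j) \<in> borel_measurable Q" by (simp add: Q(2) cong: measurable_cong_sets)
    then show ?thesis unfolding coord_marginal_def by (intro Q.real_distribution_distr)
  qed
  have atomless: "measure (coord_marginal Q j) {x} = 0" for j x
  proof -
    interpret real_distribution "coord_marginal Q j" by (rule coord)
    show ?thesis using assms(9)[of j] isCont_cdf[of x]
      by (auto simp: Q_def continuous_on_eq_continuous_at)
  qed
  define \<Theta> where "\<Theta> = {(a::real^'k, b). lam \<le> measure Q (cbox a b)}"
  have rect: "P.prob {z \<in> space P. rectangle a b (fst z) = 1} = measure Q (cbox a b)" for a b
    by (subst Q_eq(1)) (auto simp: rectangle_conv_cbox intro!: arg_cong[where f=P.prob])
  have F: "F = (\<lambda>(a, b). rectangle a b) ` \<Theta>"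
    unfolding F_def rectangle_class_def \<Theta>_def by (auto simp: rect image_iff)
  obtain a b where ab: "fstar = rectangle a b" "lam \<le> measure Q (cbox a b)"
    using assms(10) unfolding F_def[symmetric] F \<Theta>_def by auto
  have closed_\<Theta>: "closed \<Theta>"
    unfolding \<Theta>_def by (intro closed_measure_cbox_ge Q.finite_measure_axioms Q(2))
  have ZP: "Z i \<in> measurable M P" if "i \<ge> 1" for i
    using assms(13) that by (auto simp: iid_sequence_def M.indep_vars_def)
  have n_hat_sets: "{\<omega> \<in> space M. n_hat F (sample Z m \<omega>) \<le> c} \<in> M.events" for c
    unfolding sample_def using ZP
    by (intro n_hat_measurable[OF F closed_\<Theta>]) (auto simp: measurable_cong_sets[OF refl assms(7)[symmetric]])
  have B_le: "B_n_hat M F Z m \<delta> \<le> c"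
    if "1 - \<delta> \<le> M.prob {\<omega> \<in> space M. n_hat F (sample Z m \<omega>) \<le> c}" for c
    unfolding B_n_hat_def using that by (rule Least_le)
  have "real (B_n_hat M F Z m \<delta>) \<le> 8 * R"
  proof (cases "real m \<le> 8 * R")
    case True
    have "n_hat F (sample Z m \<omega>) \<le> m" for \<omega>
      unfolding sample_def by (subst n_hat_image_le_iff) (auto intro!: exI[of _ "{1..m}"])
    then have "B_n_hat M F Z m \<delta> \<le> m"
      using assms(4) by (intro B_le) (simp add: M.prob_space)
    then show ?thesis using True by linarith
  next
    case False
    then have m: "8 * R < real m" by simp
    \<comment> \<open>Chosen so that a slab of mass \<open>3 / 4 * t * lam\<close> has expected
      count exactly \<open>L\<close>, while the expected number of near points is at most
      \<open>2 * k * t * m = 8 / 3 * R\<close>.\<close>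
    define t where "t = 4 * L / (3 * real m * lam)"
    have t: "0 \<le> t" using L assms(2) by (simp add: t_def)
    define \<beta> where "\<beta> j s = flip s (if s then b $ j else a $ j)" for j s
    obtain \<gamma> U where U: "\<And>j s. U j s \<in> sets borel" "\<And>j s. U j s \<subseteq> {\<beta> j s<..}"
      "\<And>j s u v. u \<in> U j s \<Longrightarrow> \<beta> j s < v \<Longrightarrow> v \<notin> U j s \<Longrightarrow> u \<le> v"
      and strip: "\<And>j s. lam / (8 * k) \<le> measure Q {x. x \<in> cbox a b \<and> \<gamma> j s \<le> flip s (x $ j)}"
      and slab: "\<And>j s. U j s = {\<beta> j s<..} \<or> 3 / 4 * t * lam \<le>
        measure Q {x. flip s (x $ j) \<in> U j s \<and> (\<forall>i s'. i \<noteq> j \<longrightarrow> flip s' (x $ i) \<le> \<gamma> i s')}"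
      and near: "measure Q {x. \<exists>j s. flip s (x $ j) \<in> U j s} \<le> 2 * k * t"
      by (rule ex_strips_and_slabs[OF Q assms(8)[folded Q_def] atomless assms(2) ab(2) t,
        folded \<beta>_def k_def])
        (rule that)
    note U(1)[measurable]
    have nth [measurable]: "(\<lambda>x::real^'k. x $ j) \<in> borel_measurable borel" for j
      by (intro borel_measurable_continuous_onI continuous_intros)
    define StripX where "StripX j s = {x. x \<in> cbox a b \<and> \<gamma> j s \<le> flip s (x $ j)}" for j s
    define SlabX where "SlabX j s =
      {x. flip s (x $ j) \<in> U j s \<and> (\<forall>i s'. i \<noteq> j \<longrightarrow> flip s' (x $ i) \<le> \<gamma> i s')}" for j s
    define NearX where "NearX = {x. \<exists>j s. flip s (x $ j) \<in> U j s}"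
    have sets [measurable]: "StripX j s \<in> sets borel" "SlabX j s \<in> sets borel" "NearX \<in> sets borel" for j s
      unfolding StripX_def SlabX_def NearX_def by measurable
    define Strip where "Strip j s = {z \<in> space P. fst z \<in> StripX j s}" for j s
    define Slab where "Slab j s = {z \<in> space P. fst z \<in> SlabX j s}" for j s
    define Near where "Near = {z \<in> space P. fst z \<in> NearX}"
    define Wrong where "Wrong = {z \<in> space P. snd z \<noteq> rectangle a b (fst z)}"
    have Strip: "Strip j s \<in> P.events" "lam / (8 * k) \<le> P.prob (Strip j s)" for j s
      using strip[of j s,
        folded StripX_def] Q_eq[OF sets(1)] by (simp_all only: Strip_def)
    have Slab: "Slab j s \<in> P.events" "U j s = {\<beta> j s<..} \<or> 3 / 4 * t * lam \<le> P.prob (Slab j s)" for j s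
      using slab[of j s,
        folded SlabX_def] Q_eq[OF sets(2)] by (simp_all only: Slab_def)
    have Near: "Near \<in> P.events" "P.prob Near \<le> 2 * k * t"
      using near[folded NearX_def] Q_eq[OF sets(3)] by (simp_all only: Near_def)
    have Wrong: "Wrong \<in> P.events" "P.prob Wrong = 0"
      unfolding Wrong_def using realizable_by_rectangle_null assms(6,7,11) ab(1) by blast+
    define avoid where "avoid A = {\<omega> \<in> space M. \<forall>i\<in>{1..m}. Z i \<omega> \<notin> A}" for A
    have avoid_sets: "avoid A \<in> M.events" if "A \<in> P.events" for A
    proof -
      have "avoid A = space M - (\<Union>i\<in>{1..m}. Z i -` A \<inter> space M)"
        by (auto simp: avoid_def)
      also have "\<dots> \<in> M.events"
        using that ZP by (intro sets.Diff sets.finite_UN) (auto intro: measurable_sets)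
      finally show ?thesis .
    qed
    have prob_avoid: "M.prob (avoid A) \<le> exp (- L)" if "A \<in> P.events" "L \<le> real m * P.prob A" for A
    proof -
      have "M.prob (avoid A) \<le> exp (- (real m * P.prob A))"
        unfolding avoid_def by (rule M.iid_prob_avoid[OF assms(13,6) that(1)])
      also have "\<dots> \<le> exp (- L)" using that(2) by simp
      finally show ?thesis .
    qed
    \<comment> \<open>The bad events: a strip is missed, a slab is missed, there are too many near
      points, or some label is wrong. Where \<open>U j s\<close> is the whole half-line no slab
      point is required, so that component of \<open>E2\<close> is empty. Labels are correct only
      almost surely, which \<open>E4\<close> accounts for at no cost.\<close>
    define E1 where "E1 = (\<lambda>(j, s). avoid (Strip j s))"
    define E2 where "E2 = (\<lambda>(j, s). if U j s = {\<beta> j s<..} then {} else avoid (Slab j s))"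
    define E3 where "E3 = {\<omega> \<in> space M. 7 * R \<le> real (card {i\<in>{1..m}. Z i \<omega> \<in> Near})}"
    define E4 where "E4 = (\<Union>i\<in>{1..m}. Z i -` Wrong \<inter> space M)"
    have E1: "M.prob (\<Union>(range E1)) \<le> 2 * k * exp (- L)" "\<Union>(range E1) \<in> M.events"
    proof -
      have "real m * (lam / (8 * k)) \<le> real m * P.prob (Strip j s)" for j s
        using Strip(2) by (intro mult_left_mono) auto
      \<comment> \<open>A restatement of the case assumption \<open>8 * R < real m\<close>.\<close>
      moreover have "L \<le> real m * (lam / (8 * k))"
        using m k assms(2) by (simp add: R_def field_simps)
      ultimately have *: "M.prob (avoid (Strip j s)) \<le> exp (- L)" for j s
        by (intro prob_avoid Strip(1)) (rule order_trans)
      have "M.prob (\<Union>(range E1)) \<le> (\<Sum>p\<in>UNIV. M.prob (E1 p))"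
        by (intro measure_UNION_le) (auto simp: E1_def intro!: avoid_sets Strip)
      also have "\<dots> \<le> (\<Sum>p\<in>(UNIV :: ('k \<times> bool) set). exp (- L))"
        using * by (intro sum_mono) (auto simp: E1_def)
      finally show "M.prob (\<Union>(range E1)) \<le> 2 * k * exp (- L)" by (simp add: k_def card_UNIV_bool)
      show "\<Union>(range E1) \<in> M.events"
        by (intro sets.finite_UN) (auto simp: E1_def intro!: avoid_sets Strip)
    qed
    have E2: "M.prob (\<Union>(range E2)) \<le> 2 * k * exp (- L)" "\<Union>(range E2) \<in> M.events"
    proof -
      have tL: "L = real m * (3 / 4 * t * lam)"
        using assms(1,2) by (simp add: t_def field_simps)
      have "L \<le> real m * P.prob (Slab j s)" if "U j s \<noteq> {\<beta> j s<..}" for j s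
        using Slab(2)[of j s] that by (subst tL) (intro mult_left_mono; auto)
      then have *: "M.prob (E2 p) \<le> exp (- L)" for p
        using prob_avoid[OF Slab(1)] by (cases p) (auto simp: E2_def)
      have "M.prob (\<Union>(range E2)) \<le> (\<Sum>p\<in>UNIV. M.prob (E2 p))"
        by (intro measure_UNION_le) (auto simp: E2_def intro!: avoid_sets Slab)
      also have "\<dots> \<le> (\<Sum>p\<in>(UNIV :: ('k \<times> bool) set). exp (- L))"
        using * by (intro sum_mono)
      finally show "M.prob (\<Union>(range E2)) \<le> 2 * k * exp (- L)" by (simp add: k_def card_UNIV_bool)
      show "\<Union>(range E2) \<in> M.events"
        by (intro sets.finite_UN) (auto simp: E2_def intro!: avoid_sets Slab)
    qed
    have E3: "M.prob E3 \<le> exp (- L)" "E3 \<in> M.events"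
    proof -
      have "real m * P.prob Near \<le> real m * (2 * k * t)"
        using Near(2) by (intro mult_left_mono) auto
      also have "\<dots> = 8 / 3 * R"
        using assms(1,2) by (simp add: t_def R_def field_simps)
      finally have "exp (real m * P.prob Near) / 2 powr (7 * R) \<le> exp (8 / 3 * R) / 2 powr (7 * R)"
        by (intro divide_right_mono) auto
      also have "\<dots> = exp (8 / 3 * R - 7 * R * ln 2)"
        by (simp add: powr_def exp_diff)
      also have "\<dots> \<le> exp (- L)"
      proof -
        \<comment> \<open>With \<open>ln 2\<close> at least \<open>2 / 3\<close> the exponent is at
          most \<open>8 / 3 * R - 14 / 3 * R = - 2 * R\<close>, which is below
          \<open>- L\<close>.\<close>
        have "7 * R * (2 / 3) \<le> 7 * R * ln 2"
          using ln2_ge_two_thirds LR L by (intro mult_left_mono) auto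
        then have "8 / 3 * R - 7 * R * ln 2 \<le> - L" using LR L by linarith
        then show ?thesis by (simp only: exp_le_cancel_iff)
      qed
      finally show "M.prob E3 \<le> exp (- L)"
        using M.iid_prob_count_ge[OF assms(13,6) Near(1), of "7 * R" m] unfolding E3_def by linarith
      have "(\<lambda>\<omega>. \<Sum>i\<in>{1..m}. indicator Near (Z i \<omega>) :: real) \<in> borel_measurable M"
        using ZP Near(1) by (intro borel_measurable_sum borel_measurable_indicator') auto
      moreover have "real (card {i\<in>{1..m}. Z i \<omega> \<in> Near}) = (\<Sum>i\<in>{1..m}. indicator Near (Z i \<omega>))" for \<omega>
        by (simp add: indicator_def sum.If_cases Int_def)
      ultimately show "E3 \<in> M.events"
        unfolding E3_def by (simp only: borel_measurable_iff_ge)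
    qed
    have E4: "M.prob E4 = 0" "E4 \<in> M.events"
    proof -
      have sets: "Z i -` Wrong \<inter> space M \<in> M.events" if "i \<in> {1..m}" for i
        using that ZP Wrong(1) by (intro measurable_sets) auto
      have "M.prob (Z i -` Wrong \<inter> space M) = 0" if "i \<in> {1..m}" for i
        using that measure_distr[OF ZP Wrong(1), of i] assms(13) Wrong(2)
        by (simp add: iid_sequence_def)
      then have "M.prob E4 \<le> 0"
        unfolding E4_def using measure_UNION_le[of "{1..m}" "\<lambda>i. Z i -` Wrong \<inter> space M" M] sets by simp
      then show "M.prob E4 = 0" by (simp add: measure_le_0_iff)
      show "E4 \<in> M.events" unfolding E4_def using sets by blast
    qed
    let ?B = "\<Union>(range E1) \<union> \<Union>(range E2) \<union> E3 \<union> E4"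
    let ?c = "nat \<lfloor>8 * R\<rfloor>"
    \<comment> \<open>In total \<open>4 * k + 1\<close> terms
      \<open>exp (- L) = \<delta> / (8 * k)\<close>, which sum to at most
      \<open>\<delta>\<close>.\<close>
    have "M.prob ?B \<le> 2 * k * exp (- L) + 2 * k * exp (- L) + exp (- L) + 0"
      using E1 E2 E3 E4 by (intro order_trans[OF measure_Un_le] add_mono sets.Un) auto
    also have "\<dots> = \<delta> / 2 + \<delta> / (8 * k)" using k by (simp add: exp_L)
    also have "\<delta> / (8 * k) \<le> \<delta> / 2"
      using k assms(4) by (intro divide_left_mono) auto
    finally have B: "M.prob ?B \<le> \<delta>" by simp
    have B_sets: "?B \<in> M.events" using E1 E2 E3 E4 by (intro sets.Un)
    have "space M - ?B \<subseteq> {\<omega> \<in> space M. n_hat F (sample Z m \<omega>) \<le> ?c}"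
    proof
      fix \<omega> assume \<omega>: "\<omega> \<in> space M - ?B"
      let ?S = "sample Z m \<omega>"
      have Zsp: "Z i \<omega> \<in> space P" if "i \<in> {1..m}" for i
        using measurable_space[OF ZP] \<omega> that by auto
      have hit: "\<exists>z\<in>?S. z \<in> A" if "\<omega> \<notin> avoid A" for A
        using that \<omega> by (auto simp: avoid_def sample_def)
      have "n_hat F ?S \<le> 2 * CARD('k) + card {z \<in> ?S. \<exists>j s. flip s (fst z $ j) \<in> U j s}"
      proof (rule n_hat_le_card_near[where a=a and b=b and \<gamma>=\<gamma>])
        show "\<exists>a b. h = rectangle a b" if "h \<in> F" for h using that by (auto simp: F)
        show "finite ?S" by (simp add: sample_def)
        show "snd z = rectangle a b (fst z)" if "z \<in> ?S" for z
          using that \<omega> Zsp by (auto simp: sample_def E4_def Wrong_def)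
        show "\<exists>z\<in>?S. fst z \<in> cbox a b \<and> \<gamma> j s \<le> flip s (fst z $ j)" for j s
        proof -
          have "\<omega> \<notin> avoid (Strip j s)" using \<omega> by (auto simp: E1_def)
          from hit[OF this] show ?thesis by (auto simp: Strip_def StripX_def)
        qed
        show "U j s = {flip s (if s then b $ j else a $ j)<..} \<or>
          (\<exists>z\<in>?S. flip s (fst z $ j) \<in> U j s \<and> (\<forall>i s'. i \<noteq> j \<longrightarrow> flip s' (fst z $ i) \<le> \<gamma> i s'))" for j s
        proof (cases "U j s = {\<beta> j s<..}")
          case False
          then have "E2 (j, s) = avoid (Slab j s)" by (simp add: E2_def)
          then have "\<omega> \<notin> avoid (Slab j s)" using \<omega> by blast
          from hit[OF this] obtain z where "z \<in> ?S" "fst z \<in> SlabX j s" by (auto simp: Slab_def)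
          then show ?thesis unfolding SlabX_def by blast
        qed (simp add: \<beta>_def)
      qed (use U in \<open>auto simp: \<beta>_def\<close>)
      \<comment> \<open>The sample is a set while \<open>E3\<close> counts indices; repeated points
        only lower the left side.\<close>
      also have "card {z \<in> ?S. \<exists>j s. flip s (fst z $ j) \<in> U j s} \<le> card {i\<in>{1..m}. Z i \<omega> \<in> Near}"
      proof -
        have "{z \<in> ?S. fst z \<in> NearX} = (\<lambda>i. Z i \<omega>) ` {i\<in>{1..m}. Z i \<omega> \<in> Near}"
          using Zsp by (force simp: sample_def Near_def)
        then show ?thesis by (simp add: card_image_le NearX_def)
      qed
      finally have "real (n_hat F ?S) \<le> 2 * k + real (card {i\<in>{1..m}. Z i \<omega> \<in> Near})"
        unfolding k_def by linarith
      also have "real (card {i\<in>{1..m}. Z i \<omega> \<in> Near}) < 7 * R"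
        using \<omega> by (auto simp: E3_def)
      finally have "real (n_hat F ?S) \<le> 8 * R" using kR by linarith
      then show "\<omega> \<in> {\<omega> \<in> space M. n_hat F (sample Z m \<omega>) \<le> ?c}"
        using \<omega> by (simp add: le_nat_floor)
    qed
    then have "M.prob (space M - ?B) \<le> M.prob {\<omega> \<in> space M. n_hat F (sample Z m \<omega>) \<le> ?c}"
      by (intro M.finite_measure_mono n_hat_sets)
    then have "1 - \<delta> \<le> M.prob {\<omega> \<in> space M. n_hat F (sample Z m \<omega>) \<le> ?c}"
      using B M.prob_compl[OF B_sets] by linarith
    then have "B_n_hat M F Z m \<delta> \<le> ?c" by (rule B_le)
    then show ?thesis using LR L by linarith
  qed
  then show ?thesis unfolding goal F_def .
qed

end
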